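(* For $0\le r<1$, let $\lambda^{\mathrm{dom}}_{132^J}$ be the dominating eigenvalue (the eigenvalue of largest modulus) of the matrix $JP_2P_3P_1$, which is always real, and let $u_{\lambda^{\mathrm{dom}}_{132^J}}$ be an associated eigenvector (all these objects depend on $r$). Then the equation $$\alpha\,\big(u_{\lambda^{\mathrm{dom}}_{132^J}}\big)_y-\big(u_{\lambda^{\mathrm{dom}}_{132^J}}\big)_x=0$$ in the unknown $r$ has exactly one root $r_{\mathrm{crit},132^J}$ in $]0,1[$, with $$r_{\mathrm{crit},132^J}\simeq 0.2200\,6978\,6146\,3104\,7521 .$$ Moreover, for any $r\in\,]r_{\mathrm{crit},132^J},1[$, there exists a single point (up to sign) in the domain of $\widehat{\mathfrak{P}}_r$ which generates the periodic orbit $132312$, and this orbit is locally stable. This point is given by $u_{\lambda^{\mathrm{dom}}_{132^J}}/|u_{\lambda^{\mathrm{dom}}_{132^J}}|$.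
   Context: For a restitution coefficient $r$, set $\alpha=\frac{1+r}{2}$ and $$P_1=\begin{pmatrix}-r & r\alpha & 0\\ -\alpha & \alpha^2-r & r\alpha\\ 0&0&r^2\end{pmatrix},\quad P_2=\begin{pmatrix} r&-r\alpha&0\\ \alpha&-2\alpha^2+r&\alpha\\ 0&-r\alpha&r\end{pmatrix},\quad P_3=\begin{pmatrix} r^2&0&0\\ r\alpha&\alpha^2-r&-\alpha\\ 0&r\alpha&-r\end{pmatrix},\quad J=\begin{pmatrix}0&0&1\\0&1&0\\1&0&0\end{pmatrix}.$$ The subscripts $x,y,z$ denote the first, second and third components of a vector of $\mathbb{R}^3$. The mapping $\widehat{\mathfrak{P}}_r$ (the $\mathfrak{b}$-to-$\mathfrak{b}$ mapping), for $r\in\,]0,1[$, acts on unit vectors $u=(x,y,z)\in\mathbb{S}^2$, considered up to sign and normalized so that $x>0$, $z<0$. It is defined almost everywhere by $\widehat{\mathfrak{P}}_r(u)=P_iu/|P_iu|$, where $i=1$ if $\alpha y-x>0$; $i=3$ if $\alpha y-z<0$; $i=2$ if $\alpha y-x<0$ and $\alpha y-z>0$. These three regions are called the domains of $P_1,P_3,P_2$ respectively. A point $u$ generates the periodic orbit $i_1i_2\cdots i_n$ (with $i_j\in\{1,2,3\}$) if for each $1\le j\le n$ the point $\widehat{\mathfrak{P}}_r^{\,j-1}(u)$ lies in the domain of $P_{i_j}$, and $\widehat{\mathfrak{P}}_r^{\,n}(u)=u$. Such an orbit is locally stable if $u$ is a locally stable fixed point of $\widehat{\mathfrak{P}}_r^{\,n}$,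 in the sense that any orbit of $\widehat{\mathfrak{P}}_r^{\,n}$ starting sufficiently close to $u$ remains close to $u$. *)

theory Defs
  imports "HOL-Analysis.Analysis"
begin

definition alpha :: "real \<Rightarrow> real" where
  "alpha r = (1 + r) / 2"

definition P1 :: "real \<Rightarrow> real^3^3" where
  "P1 r = vector [
     vector [- r, r * alpha r, 0],
     vector [- alpha r, (alpha r)\<^sup>2 - r, r * alpha r],
     vector [0, 0, r\<^sup>2]]"

definition P2 :: "real \<Rightarrow> real^3^3" where
  "P2 r = vector [
     vector [r, - (r * alpha r), 0],
     vector [alpha r, - 2 * (alpha r)\<^sup>2 + r, alpha r],
     vector [0, - (r * alpha r), r]]"

definition P3 :: "real \<Rightarrow> real^3^3" where
  "P3 r = vector [
     vector [r\<^sup>2, 0, 0],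
     vector [r * alpha r, (alpha r)\<^sup>2 - r, - alpha r],
     vector [0, r * alpha r, - r]]"

definition J :: "real^3^3" where
  "J = vector [vector [0, 0, 1], vector [0, 1, 0], vector [1, 0, 0]]"

definition M132J :: "real \<Rightarrow> real^3^3" where
  "M132J r = J ** P2 r ** P3 r ** P1 r"


definition eigenvector :: "'a::field^'n^'n \<Rightarrow> 'a^'n \<Rightarrow> 'a \<Rightarrow> bool" where
  "eigenvector A v l \<longleftrightarrow> v \<noteq> 0 \<and> A *v v = l *s v"

definition eigenvalue :: "'a::field^'n^'n \<Rightarrow> 'a \<Rightarrow> bool" where
  "eigenvalue A l \<longleftrightarrow> (\<exists>v. eigenvector A v l)"

text \<open>Eigenvalues are taken over the complex numbers. The strict inequality makes the
  dominating eigenvalue unique whenever it exists.\<close>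

definition dominating_eigenvalue :: "real^'n^'n \<Rightarrow> complex \<Rightarrow> bool" where
  "dominating_eigenvalue A l \<longleftrightarrow>
     eigenvalue (map_matrix complex_of_real A) l \<and>
     (\<forall>m. eigenvalue (map_matrix complex_of_real A) m \<and> m \<noteq> l \<longrightarrow> cmod m < cmod l)"


text \<open>Points of the unit sphere up to sign are represented by the representative with
  positive first and negative third component. Points of the sphere without such a
  representative are not in the domain of the map.\<close>

definition phase_space :: "(real^3) set" where
  "phase_space = {u. norm u = 1 \<and> u $ 1 > 0 \<and> u $ 3 < 0}"

definition P_domain :: "real \<Rightarrow> nat \<Rightarrow> (real^3) set" where
  "P_domain r i = {u \<in> phase_space.
     (i = 1 \<and> alpha r * u $ 2 - u $ 1 > 0) \<or>
     (i = 3 \<and> alpha r * u $ 2 - u $ 3 < 0) \<or>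
     (i = 2 \<and> alpha r * u $ 2 - u $ 1 < 0 \<and> alpha r * u $ 2 - u $ 3 > 0)}"

definition normalize_vec :: "real^3 \<Rightarrow> real^3" where
  "normalize_vec v = v /\<^sub>R norm v"

text \<open>The b-to-b mapping is only defined almost everywhere, hence a partial function.
  For \<open>r > 0\<close> the three domains are pairwise disjoint, and the values lie in
  \<open>phase_space\<close> again, so that no sign change is needed after applying a matrix.\<close>

definition bb_map :: "real \<Rightarrow> real^3 \<Rightarrow> (real^3) option" where
  "bb_map r u =
     (if u \<in> P_domain r 1 then Some (normalize_vec (P1 r *v u))
      else if u \<in> P_domain r 3 then Some (normalize_vec (P3 r *v u))
      else if u \<in> P_domain r 2 then Some (normalize_vec (P2 r *v u))
      else None)"

primrec piter :: "('a \<Rightarrow> 'a option) \<Rightarrow> nat \<Rightarrow> 'a \<Rightarrow> 'a option" where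
  "piter f 0 u = Some u"
| "piter f (Suc k) u = Option.bind (piter f k u) f"

text \<open>List positions are counted from \<open>0\<close>, so \<open>w ! j\<close> is the
  symbol $i_{j+1}$.\<close>

definition generates_orbit :: "real \<Rightarrow> nat list \<Rightarrow> real^3 \<Rightarrow> bool" where
  "generates_orbit r w u \<longleftrightarrow>
     (\<forall>j < length w. \<exists>v. piter (bb_map r) j u = Some v \<and> v \<in> P_domain r (w ! j)) \<and>
     piter (bb_map r) (length w) u = Some u"

text \<open>Stability of a fixed point of a partial map on \<open>S\<close>: an orbit starting close to the
  fixed point has to be defined for all times and to remain close to it.\<close>

definition locally_stable_fixpoint ::
    "'a::metric_space set \<Rightarrow> ('a \<Rightarrow> 'a option) \<Rightarrow> 'a \<Rightarrow> bool" where
  "locally_stable_fixpoint S f u \<longleftrightarrow>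
     u \<in> S \<and> f u = Some u \<and>
     (\<forall>\<epsilon>>0. \<exists>\<delta>>0. \<forall>v\<in>S. dist v u < \<delta> \<longrightarrow>
        (\<forall>k. \<exists>v'. piter f k v = Some v' \<and> dist v' u < \<epsilon>))"

definition locally_stable_orbit :: "real \<Rightarrow> nat list \<Rightarrow> real^3 \<Rightarrow> bool" where
  "locally_stable_orbit r w u \<longleftrightarrow>
     generates_orbit r w u \<and>
     locally_stable_fixpoint phase_space (piter (bb_map r) (length w)) u"

end

theory Submission
  imports Defs
begin

text \<open>The word $132312$ is a half orbit followed by its mirror image.  Reversing the coordinates and
changing all signs, $x \mapsto -Jx$, preserves the phase space, exchanges the domains of $P_1$ and
$P_3$ and conjugates $P_1$ to $P_3$ and $P_2$ to itself.  With \<open>M = J P2 P3 P1\<close>, three steps along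
$132$ send \<open>x\<close> to the mirror image of \<open>- M x\<close>, and all six steps amount to \<open>M\<^sup>2\<close>.  Hence a unit
vector generates the orbit iff \<open>x\<close> and \<open>- M x\<close> lie in the open convex cone \<open>half_orbit\<close> of the
points that can follow $132$, and \<open>M\<^sup>2 x\<close> is a positive multiple of \<open>x\<close> (\<open>orbit_132312\<close>).

Eigenvalues. With \<open>t\<close> the trace and \<open>s\<close> the sum of the principal minors, and since
\<open>det M = - r\<^sup>1\<^sup>1\<close>, a number \<open>- y\<close> is an eigenvalue iff
\<open>q(y) = y\<^sup>3 + t y\<^sup>2 + s y - r\<^sup>1\<^sup>1\<close> vanishes.  Exhibiting points where \<open>q\<close> is negative gives a root \<open>y\<close>
so large that the two remaining eigenvalues, the roots of a real quadratic, satisfy the Schur-Cohn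
conditions for the disc of radius \<open>y\<close> (\<open>dominating_root_exists\<close>).  So \<open>- y\<close> dominates.  For
\<open>r \<ge> 0.22\<close> this \<open>y\<close> is the only positive root of \<open>q\<close>, so the sign of \<open>q\<close> at a positive number
compares it with \<open>y\<close> (\<open>qM_sign\<close>).

Eigenvectors. In the coordinates \<open>u\<^sub>1\<close>, \<open>u\<^sub>3\<close> and \<open>gap u = \<alpha> u\<^sub>2 - u\<^sub>1\<close>, and with
\<open>\<beta> = \<alpha>\<^sup>2 - r\<close>, the ratios of the coordinates of an eigenvector are explicit quotients of
polynomials in \<open>y\<close>; in particular the gap is a multiple of \<open>(r - 2\<beta>) y + r\<^sup>5\<close> (\<open>eigen_gap\<close>).
It can vanish only if \<open>r\<^sup>5 / (2\<beta> - r)\<close> is the dominating root, and inserting this value into \<open>q\<close> leaves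
\<open>(1 - r)\<^sup>4 (1 - 6r + r\<^sup>2) (5 - 22r - 2r\<^sup>2 - 6r\<^sup>3 + r\<^sup>4)\<close> up to a nonzero factor
(\<open>qM_at_critical\<close>).  The quadratic factor belongs to an eigenvalue that does not dominate; the
quartic is decreasing on $[0,1]$ and its root there is the critical parameter.  Beyond that root, the
sign of \<open>q\<close> at a few explicit numbers shows that the dominating eigenvector lies in \<open>half_orbit\<close>.

Uniqueness and stability. If \<open>M\<^sup>2 x = m x\<close> with \<open>m > 0\<close>, then \<open>M x \<plusminus> \<surd>m x\<close> are eigenvectors of \<open>M\<close> or
zero; the first coordinates of \<open>x\<close> and \<open>- M x\<close> being positive, \<open>- \<surd>m\<close> is an eigenvalue, hence
\<open>\<surd>m = y\<close> and \<open>x\<close> is a dominating eigenvector (\<open>orbit_point_is_eigenvector\<close>).  For stability, the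
powers of \<open>- M / y\<close> are bounded because its other eigenvalues lie inside the unit disc, so nearby
points stay near the eigenvector and keep its itinerary (\<open>eigenvector_stable\<close>).\<close>

section \<open>Certified positivity of polynomials on intervals\<close>

text \<open>Polynomials are coefficient lists, constant term first, so that the simplifier can compute with them.\<close>

definition poly_val :: "real list \<Rightarrow> real \<Rightarrow> real" where
  "poly_val cs x = foldr (\<lambda>c acc. c + x * acc) cs 0"

lemma poly_val_simps: "poly_val [] x = 0" "poly_val (c # cs) x = c + x * poly_val cs x"
  by (simp_all add: poly_val_def)

text \<open>Coefficients of \<open>c + (a + X) p\<close>, where \<open>p\<close> has the coefficients of the third argument.\<close>

fun lin_mul :: "real \<Rightarrow> real \<Rightarrow> real list \<Rightarrow> real list" where
  "lin_mul a c [] = [c]"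
| "lin_mul a c (t # ts) = (c + a * t) # lin_mul a t ts"

fun taylor_shift :: "real \<Rightarrow> real list \<Rightarrow> real list" where
  "taylor_shift a [] = []"
| "taylor_shift a (c # cs) = lin_mul a c (taylor_shift a cs)"

text \<open>Horner's scheme in interval arithmetic on $[0,w]$, keeping only the lower end of each interval:
multiplying by \<open>h \<in> [0,w]\<close> can lower a value only if it is negative, and then most at \<open>h = w\<close>.\<close>

fun horner_lower :: "real \<Rightarrow> real list \<Rightarrow> real" where
  "horner_lower w [] = 0"
| "horner_lower w (c # cs) = c + w * min 0 (horner_lower w cs)"

lemma poly_val_lin_mul: "poly_val (lin_mul a c ts) h = c + (a + h) * poly_val ts h"
  by (induction ts arbitrary: c) (simp_all add: poly_val_simps algebra_simps)

lemma poly_val_taylor_shift: "poly_val (taylor_shift a cs) h = poly_val cs (a + h)"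
  by (induction cs) (simp_all add: poly_val_simps poly_val_lin_mul)

lemma horner_lower_le:
  assumes "0 \<le> h" "h \<le> w"
  shows "horner_lower w cs \<le> poly_val cs h"
proof (induction cs)
  case (Cons c cs)
  have "w * min 0 (horner_lower w cs) \<le> h * min 0 (horner_lower w cs)"
    using assms by (intro mult_right_mono_neg) auto
  also have "\<dots> \<le> h * poly_val cs h"
    using Cons.IH assms by (intro mult_left_mono) auto
  finally show ?case by (simp add: poly_val_simps)
qed (simp add: poly_val_simps)

fun pos_on_grid :: "real list \<Rightarrow> real list \<Rightarrow> bool" where
  "pos_on_grid cs (a # b # bs) \<longleftrightarrow>
     0 < horner_lower (b - a) (taylor_shift a cs) \<and> pos_on_grid cs (b # bs)"
| "pos_on_grid cs _ \<longleftrightarrow> True"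

text \<open>A numerical certificate for positivity on an interval: expanding the polynomial at the left end of each
cell makes the crude Horner bound accurate enough, provided the cells are short where the polynomial is
small.\<close>

lemma pos_on_grid:
  assumes "pos_on_grid cs (a # bs)" "bs \<noteq> []" "a \<le> x" "x \<le> last bs"
  shows "0 < poly_val cs x"
  using assms
proof (induction bs arbitrary: a)
  case (Cons b bs)
  show ?case
  proof (cases "x \<le> b")
    case True
    have "0 < horner_lower (b - a) (taylor_shift a cs)" using Cons.prems by simp
    also have "\<dots> \<le> poly_val (taylor_shift a cs) (x - a)"
      using True Cons.prems by (intro horner_lower_le) auto
    finally show ?thesis by (simp add: poly_val_taylor_shift)
  next
    case False
    then show ?thesis using Cons by (cases bs) auto
  qed
qed simp

section \<open>The characteristic polynomial\<close>

text \<open>The trace and the sum of the principal minors of \<open>M132J r\<close>, see \<open>trace3_M132J\<close> and \<open>minors3_M132J\<close>.\<close>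

definition trM :: "real \<Rightarrow> real" where
  "trM r = (-1 + 8*r - 21*r^2 + 29*r^4 + 24*r^5 - 7*r^6) / 32"

definition minM :: "real \<Rightarrow> real" where
  "minM r = r^5 * (7 - 24*r - 29*r^2 + 21*r^4 - 8*r^5 + r^6) / 32"

text \<open>The characteristic polynomial at \<open>- y\<close>, with the opposite sign; the dominating eigenvalue is negative,
so its positive roots are the quantities to work with.\<close>

definition qM :: "real \<Rightarrow> real \<Rightarrow> real" where
  "qM r y = y^3 + trM r * y^2 + minM r * y - r^11"

text \<open>Written like this, the coordinates show that each \<open>P\<^sub>i\<close> keeps the first coordinate positive and the third
one negative on its own domain.\<close>

lemma P_vec:
  "(P1 r *v v) $ 1 = r * (alpha r * v $ 2 - v $ 1)"
  "(P1 r *v v) $ 2 = - alpha r * v $ 1 + ((alpha r)\<^sup>2 - r) * v $ 2 + r * alpha r * v $ 3"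
  "(P1 r *v v) $ 3 = r\<^sup>2 * v $ 3"
  "(P2 r *v v) $ 1 = r * (v $ 1 - alpha r * v $ 2)"
  "(P2 r *v v) $ 2 = alpha r * v $ 1 + (r - 2 * (alpha r)\<^sup>2) * v $ 2 + alpha r * v $ 3"
  "(P2 r *v v) $ 3 = r * (v $ 3 - alpha r * v $ 2)"
  "(P3 r *v v) $ 1 = r\<^sup>2 * v $ 1"
  "(P3 r *v v) $ 2 = r * alpha r * v $ 1 + ((alpha r)\<^sup>2 - r) * v $ 2 - alpha r * v $ 3"
  "(P3 r *v v) $ 3 = r * (alpha r * v $ 2 - v $ 3)"
  "(J *v v) $ 1 = v $ 3" "(J *v v) $ 2 = v $ 2" "(J *v v) $ 3 = v $ 1"
  by (simp_all add: P1_def P2_def P3_def J_def matrix_vector_mult_def sum_3 vector_3 algebra_simps)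

lemma M132J_vec: "M132J r *v v = J *v (P2 r *v (P3 r *v (P1 r *v v)))"
  by (simp add: M132J_def matrix_vector_mul_assoc matrix_mul_assoc)

lemma matrix_entry: "(A :: real^3^3) $ i $ j = (A *v axis j 1) $ i"
  by (simp add: matrix_vector_mult_basis column_def)

lemma M132J_entries:
    "M132J r $ 1 $ 1 = (r - 4*r^2 - 6*r^3 + 4*r^4 + 5*r^5) / 16"
    "M132J r $ 1 $ 2 = (7*r^2 - r - 10*r^3 - 18*r^4 - 5*r^5 - 5*r^6) / 32"
    "M132J r $ 1 $ 3 = (8*r^3 - r^2 + 2*r^4 + 8*r^5 - r^6) / 16"
    "M132J r $ 2 $ 1 = (1 - 3*r - 2*r^2 - 10*r^3 - 7*r^4 + 5*r^5) / 16"
    "M132J r $ 2 $ 2 = (-1 + 6*r - 11*r^2 + 4*r^3 + r^4 + 6*r^5 - 5*r^6) / 32"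
    "M132J r $ 2 $ 3 = (7*r^2 - r + 2*r^3 + 2*r^4 + 7*r^5 - r^6) / 16"
    "M132J r $ 3 $ 1 = (r + 2*r^3 - 8*r^4 + 5*r^5) / 16"
    "M132J r $ 3 $ 2 = (3*r^2 - r - 6*r^3 + 2*r^4 + 7*r^5 - 5*r^6) / 32"
    "M132J r $ 3 $ 3 = (4*r^3 - r^2 + 10*r^4 + 4*r^5 - r^6) / 16"
  unfolding matrix_entry[of "M132J r"] M132J_vec P_vec
  by (simp_all add: axis_def alpha_def power_numeral_reduce field_simps)

definition trace3 :: "'a::field^3^3 \<Rightarrow> 'a" where
  "trace3 A = A$1$1 + A$2$2 + A$3$3"

definition minors3 :: "'a::field^3^3 \<Rightarrow> 'a" where
  "minors3 A = A$1$1 * A$2$2 - A$1$2 * A$2$1 + A$1$1 * A$3$3 - A$1$3 * A$3$1 + A$2$2 * A$3$3 - A$2$3 * A$3$2"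

lemma det_minus_mat3:
  fixes A :: "'a::field^3^3"
  shows "det (A - mat x) = - (x^3 - trace3 A * x^2 + minors3 A * x - det A)"
  by (simp add: det_3 mat_def trace3_def minors3_def power_numeral_reduce algebra_simps)

lemma eigenvalue_iff_det:
  fixes A :: "'a::field^'n^'n"
  shows "eigenvalue A x \<longleftrightarrow> det (A - mat x) = 0"
proof -
  have "(A - mat x) *v v = 0 \<longleftrightarrow> A *v v = x *s v" for v
  proof -
    have "mat x *v v = x *s v"
      by (simp add: vec_eq_iff matrix_vector_mult_def mat_def if_distrib[of "\<lambda>z. z * _"] cong: if_cong)
    then show ?thesis by (simp add: matrix_vector_mult_diff_rdistrib)
  qed
  then have "eigenvalue A x \<longleftrightarrow> (\<exists>v. v \<noteq> 0 \<and> (A - mat x) *v v = 0)"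
    by (simp add: eigenvalue_def eigenvector_def)
  also have "\<dots> \<longleftrightarrow> \<not> invertible (A - mat x)"
    using matrix_left_invertible_ker[of "A - mat x"] invertible_left_inverse[of "A - mat x"] by blast
  finally show ?thesis by (simp add: invertible_det_nz)
qed

lemma cayley_hamilton3:
  fixes A :: "'a::field^3^3"
  shows "A *v (A *v (A *v v)) = trace3 A *s (A *v (A *v v)) - minors3 A *s (A *v v) + det A *s v"
  unfolding vec_eq_iff forall_3
  by (simp add: matrix_vector_mult_def sum_3 det_3 trace3_def minors3_def) algebra

lemma trace3_M132J: "trace3 (M132J r) = trM r"
  by (simp add: trace3_def M132J_entries trM_def power_numeral_reduce field_simps)

text \<open>The denominators are cleared first, because the remaining polynomial identity is within reach of
Groebner bases.\<close>

lemma minors3_M132J: "minors3 (M132J r) = minM r"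
proof -
  have clear: "a / 16 * (b / 32) - c / 32 * (d / 16) + a / 16 * (e / 16) - f / 16 * (g / 16)
      + b / 32 * (e / 16) - h / 16 * (k / 32) = z / 32"
    if "a * b - c * d + 2 * a * e - 2 * f * g + b * e - h * k = 16 * z"
    for a b c d e f g h k z :: real
    using that by (simp add: field_simps)
  show ?thesis
    unfolding minors3_def M132J_entries minM_def
    by (rule clear) algebra
qed
lemma det_M132J: "det (M132J r) = - (r^11)"
proof -
  have "det (P1 r) = r^4" "det (P3 r) = r^4" "det (P2 r) = r^3" "det J = -1"
    by (simp_all add: det_3 P1_def P2_def P3_def J_def vector_3 power2_eq_square power3_eq_cube power4_eq_xxxx algebra_simps)
  then show ?thesis by (simp add: M132J_def det_mul power_numeral_reduce)
qed
lemma eigenvalue_M132J_complex: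
  "eigenvalue (map_matrix complex_of_real (M132J r)) x \<longleftrightarrow>
     x^3 - of_real (trM r) * x^2 + of_real (minM r) * x + of_real (r^11) = 0"
proof -
  let ?B = "map_matrix complex_of_real (M132J r)"
  have "trace3 ?B = of_real (trace3 (M132J r))" "minors3 ?B = of_real (minors3 (M132J r))"
    "det ?B = of_real (det (M132J r))"
    by (simp_all add: trace3_def minors3_def det_3)
  then have "det (?B - mat x) = - (x^3 - of_real (trM r) * x^2 + of_real (minM r) * x + of_real (r^11))"
    by (simp add: det_minus_mat3 trace3_M132J minors3_M132J det_M132J)
  then show ?thesis
    by (simp only: eigenvalue_iff_det neg_equal_0_iff_equal)
qed

section \<open>The dominating eigenvalue\<close>

lemma trM_neg:
  assumes "0 \<le> r" "r \<le> 22/100"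
  shows "trM r < 0"
proof -
  have "0 < poly_val [1, -8, 21, 0, -29, -24, 7] r"
    by (rule pos_on_grid[where a=0 and bs="[12/100, 22/100]"]) (use assms in \<open>simp_all add: min_def\<close>)
  also have "\<dots> = - 32 * trM r"
    by (simp add: poly_val_simps trM_def power_numeral_reduce algebra_simps)
  finally show ?thesis by simp
qed

text \<open>This quantity is \<open>- q(- t)\<close>, and for \<open>s < 0\<close> also \<open>- q(\<surd>(- s))\<close>: its positivity bounds the
dominating root from below by \<open>- t\<close> where \<open>t < 0\<close>, and by \<open>\<surd>(- s)\<close> where \<open>s < 0\<close>.  It changes sign near \<open>r = 0.2145\<close>, which is why the estimate starts at
\<open>0.22\<close>, just below the critical parameter.\<close>

lemma trace_minors_bound:
  assumes "22/100 \<le> r" "r < 1"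
  shows "0 < trM r * minM r + r^11"
proof -
  have "0 < poly_val [-7, 80, -324, 432, 150, 432, -324, 80, -7] r"
    by (rule pos_on_grid[where a="22/100" and bs="[1]"]) (use assms in \<open>simp_all add: min_def\<close>)
  moreover have "0 < r^5 * (1-r)^2 * (1+r)^2 / 1024" using assms by simp
  moreover have "trM r * minM r + r^11 = r^5 * (1-r)^2 * (1+r)^2 / 1024 *
      poly_val [-7, 80, -324, 432, 150, 432, -324, 80, -7] r"
    by (simp add: poly_val_simps trM_def minM_def power_numeral_reduce field_simps)
  ultimately show ?thesis by (simp only: mult_pos_pos)
qed

text \<open>For small \<open>r\<close> the dominating root is close to \<open>- t\<close>, which is \<open>1/32\<close> at \<open>r = 0\<close>.  The line starts at
\<open>1/64\<close> and runs between \<open>- t / 2\<close> and the root.\<close>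

lemma lower_bound_small:
  assumes "0 \<le> r" "r \<le> 19/100"
  shows "qM r ((5 - 21*r) / 320) < 0" "- trM r \<le> 2 * ((5 - 21*r) / 320)" "r^11 < ((5 - 21*r) / 320)^3"
    "0 < (5 - 21*r) / 320"
proof -
  have "0 < poly_val [125, -2525, 19845, -70119, 85360, -57100, 778660, -1269340, -1917930,
      -336000, 1539200, 32214400, 67200] r"
    by (rule pos_on_grid[where a=0 and bs="[0.049,0.088,0.12,0.146,0.165,0.178,0.19]"])
      (use assms in \<open>simp_all add: min_def\<close>)
  also have "\<dots> = - 32768000 * qM r ((5 - 21*r) / 320)"
    by (simp add: poly_val_simps qM_def trM_def minM_def power_numeral_reduce field_simps)
  finally show "qM r ((5 - 21*r) / 320) < 0" by simp
next
  have "0 < poly_val [19, -105, 0, 145, 120, -35] r"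
    by (rule pos_on_grid[where a=0 and bs="[0.17,0.19]"])
      (use assms in \<open>simp_all add: min_def\<close>)
  then have "0 \<le> r * poly_val [19, -105, 0, 145, 120, -35] r" using assms by simp
  also have "\<dots> = 160 * (2 * ((5 - 21*r) / 320) + trM r)"
    by (simp add: poly_val_simps trM_def power_numeral_reduce field_simps)
  finally show "- trM r \<le> 2 * ((5 - 21*r) / 320)" by argo
next
  have "r^11 \<le> (19/100)^11" using assms by (intro power_mono) auto
  also have "\<dots> < ((5 - 21*(19/100)) / 320)^3" by (simp add: power_numeral_reduce)
  also have "\<dots> \<le> ((5 - 21*r) / 320)^3" using assms by (intro power_mono) auto
  finally show "r^11 < ((5 - 21*r) / 320)^3" .
  show "0 < (5 - 21*r) / 320" using assms by simp
qed

text \<open>The number \<open>r\<^sup>3 (1 + 2r) / 3\<close> exceeds the cube root of \<open>r\<^sup>1\<^sup>1\<close> by the inequality between the arithmetic and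
geometric means of \<open>1\<close>, \<open>r\<close>, \<open>r\<close>, with contact at \<open>r = 1\<close>, where all eigenvalues reach modulus 1.\<close>

lemma lower_bound_large:
  assumes "19/100 \<le> r" "r < 1"
  shows "qM r (r^3 * (1 + 2*r) / 3) < 0" "- trM r \<le> 2 * (r^3 * (1 + 2*r) / 3)"
    "r^11 < (r^3 * (1 + 2*r) / 3)^3" "0 < r^3 * (1 + 2*r) / 3"
proof -
  have "0 < poly_val [3, -9, -93, 121, 787, 1369, 309, -201, 18] r"
    by (rule pos_on_grid[where a="0.19" and bs="[0.6,1]"]) (use assms in \<open>simp_all add: min_def\<close>)
  moreover have "qM r (r^3 * (1 + 2*r) / 3) = - (r^6 * (1 - r) / 864 *
      poly_val [3, -9, -93, 121, 787, 1369, 309, -201, 18] r)"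
    by (simp add: poly_val_simps qM_def trM_def minM_def power_numeral_reduce field_simps)
  ultimately show "qM r (r^3 * (1 + 2*r) / 3) < 0" using assms by simp
next
  have "0 < poly_val [-3, 24, -63, 64, 215, 72, -21] r"
    by (rule pos_on_grid[where a="0.19" and bs="[1]"]) (use assms in \<open>simp_all add: min_def\<close>)
  also have "\<dots> = 96 * (2 * (r^3 * (1 + 2*r) / 3) + trM r)"
    by (simp add: poly_val_simps trM_def power_numeral_reduce field_simps)
  finally show "- trM r \<le> 2 * (r^3 * (1 + 2*r) / 3)" by simp
next
  have "(r^3 * (1 + 2*r) / 3)^3 - r^11 = r^9 * (1-r)^2 * (1 + 8*r) / 27"
    by (simp add: power_numeral_reduce field_simps)
  then show "r^11 < (r^3 * (1 + 2*r) / 3)^3" using assms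
    by (smt (verit) divide_pos_pos mult_pos_pos zero_less_power)
  show "0 < r^3 * (1 + 2*r) / 3" using assms by simp
qed

text \<open>The Schur-Cohn criterion. Two conjugate roots have squared modulus \<open>c\<close>. If the roots are real, the
polynomial is positive at both \<open>y\<close> and \<open>- y\<close>, so a root outside \<open>(- y, y)\<close> would force the other one
outside as well, against \<open>\<bar>c\<bar> < y\<^sup>2\<close>.\<close>

lemma schur_cohn_quadratic:
  fixes b c y :: real and m :: complex
  assumes root: "m^2 + of_real b * m + of_real c = 0"
    and y: "0 < y" and c: "\<bar>c\<bar> < y^2" and b: "\<bar>b\<bar> * y < y^2 + c"
  shows "cmod m < y"
proof -
  obtain x z where m: "m = Complex x z" by (cases m)
  have re: "x^2 - z^2 + b * x + c = 0" and im: "z * (2 * x + b) = 0"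
    using root by (simp_all add: m complex_eq_iff power2_eq_square algebra_simps)
  show ?thesis
  proof (cases "z = 0")
    case True
    define x' where "x' = - b - x"
    have prod: "x * x' = c" and sum: "x + x' = - b"
      using re True by (simp_all add: x'_def power2_eq_square algebra_simps)
    have "0 < (y - x) * (y - x')" "0 < (y + x) * (y + x')"
    proof -
      have "(y - x) * (y - x') = y^2 + b * y + c" "(y + x) * (y + x') = y^2 - b * y + c"
        using re True by (simp_all add: x'_def power2_eq_square algebra_simps)
      moreover have "\<bar>b * y\<bar> < y^2 + c" using b y by (simp add: abs_mult)
      ultimately show "0 < (y - x) * (y - x')" "0 < (y + x) * (y + x')" by linarith+
    qed
    moreover have "\<not> (y \<le> \<bar>x\<bar> \<and> y \<le> \<bar>x'\<bar>)"
    proof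
      assume "y \<le> \<bar>x\<bar> \<and> y \<le> \<bar>x'\<bar>"
      then have "y * y \<le> \<bar>x\<bar> * \<bar>x'\<bar>" using y by (intro mult_mono) auto
      then show False using c prod by (simp add: power2_eq_square flip: abs_mult)
    qed
    ultimately have "\<bar>x\<bar> < y"
      unfolding zero_less_mult_iff using y by linarith
    then show ?thesis by (simp add: m True cmod_def)
  next
    case False
    then have "b = - 2 * x" using im by simp
    then have "(cmod m)^2 = c" using re by (simp add: m cmod_power2) (simp add: power2_eq_square)
    then have "(cmod m)^2 < y^2" using c by linarith
    then show ?thesis using y by (simp add: power_less_imp_less_base)
  qed
qed

lemma qM_factor:
  assumes "qM r y = 0"
  shows "qM r z = (z - y) * (z^2 + (trM r + y) * z + (y^2 + trM r * y + minM r))"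
  using assms unfolding qM_def by algebra

lemma charpoly_factor:
  fixes x :: complex
  assumes "qM r y = 0"
  shows "x^3 - of_real (trM r) * x^2 + of_real (minM r) * x + of_real (r^11) =
    (x + of_real y) * (x^2 + of_real (- (trM r + y)) * x + of_real (y^2 + trM r * y + minM r))"
proof -
  have "r^11 = y^3 + trM r * y^2 + minM r * y" using assms by (simp add: qM_def)
  then have "complex_of_real (r^11) = of_real y^3 + of_real (trM r) * of_real y^2 + of_real (minM r) * of_real y"
    by (simp flip: of_real_power of_real_mult of_real_add)
  then show ?thesis by (simp add: algebra_simps power2_eq_square power3_eq_cube)
qed

text \<open>After splitting off the eigenvalue \<open>- y\<close>, the quadratic has constant term \<open>c = r\<^sup>1\<^sup>1 / y\<close>.  The three
inequalities translate into \<open>c < y\<^sup>2\<close>, \<open>t y < c\<close> and \<open>- t y < 2 y\<^sup>2 + c\<close>, which are the Schur-Cohn conditions.\<close>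

lemma other_roots_smaller:
  fixes m :: complex
  assumes "0 \<le> r" "0 < y" and q: "qM r y = 0" and prod: "r^11 < y^3"
    and upper: "trM r * y^2 < r^11" and lower: "- trM r < 2 * y"
    and root: "m^2 + of_real (- (trM r + y)) * m + of_real (y^2 + trM r * y + minM r) = 0"
  shows "cmod m < y"
proof -
  define c where "c = y^2 + trM r * y + minM r"
  have cy: "c * y = r^11"
    using q by (simp add: c_def qM_def power2_eq_square power3_eq_cube algebra_simps)
  have "c < y^2"
    using prod \<open>0 < y\<close> by (simp add: power2_eq_square power3_eq_cube flip: cy)
  moreover have "0 \<le> c * y" using \<open>0 \<le> r\<close> by (simp add: cy)
  then have "0 \<le> c" using \<open>0 < y\<close> by (simp add: zero_le_mult_iff)
  ultimately have c: "\<bar>c\<bar> < y^2" by simp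
  have "trM r * y < c"
    using upper \<open>0 < y\<close> by (simp add: power2_eq_square flip: cy mult.assoc)
  moreover have "- trM r * y < 2 * y^2 + c"
    using mult_strict_right_mono[OF lower \<open>0 < y\<close>] \<open>0 \<le> c\<close> by (simp add: power2_eq_square)
  ultimately have b: "\<bar>- (trM r + y)\<bar> * y < y^2 + c"
    using \<open>0 < y\<close> by (auto simp: abs_if power2_eq_square algebra_simps)
  show ?thesis
    by (rule schur_cohn_quadratic[OF root[folded c_def]]) (use \<open>0 < y\<close> c b in auto)
qed

lemma dominating_of_root:
  assumes "0 < y" and q: "qM r y = 0"
    and others: "\<And>m. m^2 + of_real (- (trM r + y)) * m + of_real (y^2 + trM r * y + minM r) = 0 \<Longrightarrow> cmod m < y"
  shows "dominating_eigenvalue (M132J r) (of_real (- y))"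
proof -
  have "cmod m < y" if "eigenvalue (map_matrix complex_of_real (M132J r)) m" "m \<noteq> of_real (- y)" for m
  proof (rule others)
    have "m + of_real y \<noteq> 0" using that(2) by (simp add: eq_neg_iff_add_eq_0)
    with that(1) show "m^2 + of_real (- (trM r + y)) * m + of_real (y^2 + trM r * y + minM r) = 0"
      unfolding eigenvalue_M132J_complex charpoly_factor[OF q] by simp
  qed
  moreover have "eigenvalue (map_matrix complex_of_real (M132J r)) (of_real (- y))"
    unfolding eigenvalue_M132J_complex charpoly_factor[OF q] by simp
  ultimately show ?thesis using \<open>0 < y\<close> by (simp add: dominating_eigenvalue_def)
qed

text \<open>Since \<open>q\<close> is eventually positive, every point where it is negative is a lower bound for a root.\<close>

lemma qM_root_above:
  assumes "qM r z < 0" "0 < z"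
  obtains y where "z < y" "qM r y = 0"
proof -
  define B where "B = z + 1 + \<bar>trM r\<bar> + \<bar>minM r\<bar> + \<bar>r^11\<bar>"
  have B: "1 \<le> B" using assms by (simp add: B_def)
  have "0 \<le> qM r B"
  proof -
    have 1: "B \<le> B^2" "1 \<le> B^2" using B by (simp_all add: self_le_power)
    have "- trM r * B^2 \<le> \<bar>trM r\<bar> * B^2" by (intro mult_right_mono) auto
    moreover have "- minM r * B \<le> \<bar>minM r\<bar> * B^2" using 1 B by (intro mult_mono) auto
    moreover have "r^11 \<le> \<bar>r^11\<bar> * B^2" using mult_left_mono[OF 1(2) abs_ge_zero[of "r^11"]] by simp
    moreover have "B^3 = B^2 * (z + 1) + (\<bar>trM r\<bar> * B^2 + \<bar>minM r\<bar> * B^2 + \<bar>r^11\<bar> * B^2)"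
    proof -
      have "B^2 * B = B^2 * (z + 1 + \<bar>trM r\<bar> + \<bar>minM r\<bar> + \<bar>r^11\<bar>)" by (simp only: B_def)
      then show ?thesis by (simp add: power2_eq_square power3_eq_cube distrib_left)
    qed
    moreover have "0 \<le> B^2 * (z + 1)" using assms by simp
    ultimately show ?thesis unfolding qM_def by linarith
  qed
  moreover have "z \<le> B" by (simp add: B_def)
  moreover have "continuous_on {z..B} (qM r)" unfolding qM_def by (intro continuous_intros)
  ultimately obtain y where "z \<le> y" "qM r y = 0"
    using IVT'[of "qM r" z 0 B] assms by auto
  moreover from this have "z \<noteq> y" using assms by auto
  ultimately show ?thesis using that by force
qed

text \<open>The root is taken above several numbers at once: above \<open>z\<close>, which gives \<open>r\<^sup>1\<^sup>1 < y\<^sup>3\<close> and \<open>- t < 2 y\<close>, and,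
when \<open>t > 0 > s\<close>, above \<open>\<surd>(- s)\<close>, which gives \<open>t y\<^sup>2 < r\<^sup>1\<^sup>1\<close> because \<open>r\<^sup>1\<^sup>1 - t y\<^sup>2 = y (y\<^sup>2 + s)\<close>.\<close>

lemma dominating_root_exists:
  assumes r: "0 \<le> r" "r < 1"
  obtains y where "0 < y" "qM r y = 0" "r^11 < y^3"
    "\<And>m. m^2 + of_real (- (trM r + y)) * m + of_real (y^2 + trM r * y + minM r) = 0 \<Longrightarrow> cmod m < y"
proof -
  obtain z where z: "0 < z" "qM r z < 0" "- trM r \<le> 2 * z" "r^11 < z^3"
    using lower_bound_small[OF r(1)] lower_bound_large[OF _ r(2)] by (meson linear)
  define z' where "z' = (if 0 < trM r \<and> minM r < 0 then sqrt (- minM r) else z)"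
  have "qM r z' < 0 \<and> 0 < z'"
  proof (cases "0 < trM r \<and> minM r < 0")
    case True
    then have "22/100 \<le> r" using trM_neg[of r] r by linarith
    then have "0 < trM r * minM r + r^11" using trace_minors_bound r by simp
    moreover have "qM r (sqrt (- minM r)) = - (trM r * minM r + r^11)"
      using True by (simp add: qM_def power3_eq_cube)
    ultimately show ?thesis using True by (simp add: z'_def)
  next
    case False
    then have "z' = z" unfolding z'_def by (rule if_not_P)
    then show ?thesis using z by simp
  qed
  then have "qM r (max z z') < 0" "0 < max z z'" using z by (auto simp: max_def)
  from qM_root_above[OF this] obtain y where "max z z' < y" and q: "qM r y = 0" by blast
  then have y: "z < y" "z' < y" "0 < y" using z by auto
  have "z^3 < y^3" using y z by (intro power_strict_mono) auto
  then have prod: "r^11 < y^3" using z by simp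
  have "trM r * y^2 < r^11"
  proof (cases "0 < trM r")
    case True
    have "0 < y^2 + minM r"
    proof (cases "minM r < 0")
      case neg: True
      then have "sqrt (- minM r) < y" using y True by (simp add: z'_def)
      then have "(sqrt (- minM r))^2 < y^2" using y neg by (intro power_strict_mono) auto
      then show ?thesis using neg by simp
    qed (use y in \<open>simp add: add_pos_nonneg\<close>)
    then have "0 < y * (y^2 + minM r)" using y by simp
    also have "\<dots> = r^11 - trM r * y^2"
      using q by (simp add: qM_def power2_eq_square power3_eq_cube algebra_simps)
    finally show ?thesis by simp
  next
    case False
    show ?thesis
    proof (cases "r = 0")
      case True
      then show ?thesis using y by (simp add: trM_def)
    next
      case False
      then have "0 < r^11" using r by simp
      moreover have "trM r * y^2 \<le> 0" using \<open>\<not> 0 < trM r\<close> by (simp add: mult_nonpos_nonneg)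
      ultimately show ?thesis by linarith
    qed
  qed
  moreover have "- trM r < 2 * y" using z y by simp
  ultimately show ?thesis using that other_roots_smaller[OF r(1) y(3) q prod] y(3) q prod by blast
qed

lemma dominating_eigenvalue_unique:
  assumes "dominating_eigenvalue A l" "dominating_eigenvalue A l'"
  shows "l = l'"
  using assms unfolding dominating_eigenvalue_def by (metis less_asym)

lemma dominating_real:
  assumes "0 \<le> r" "r < 1" "dominating_eigenvalue (M132J r) (of_real l)"
  shows "l < 0" "qM r (- l) = 0" "r^11 < (- l)^3"
    "\<And>m. m^2 + of_real (- (trM r - l)) * m + of_real (l^2 - trM r * l + minM r) = 0 \<Longrightarrow> cmod m < - l"
proof -
  obtain y where y: "0 < y" "qM r y = 0" "r^11 < y^3"
    "\<And>m. m^2 + of_real (- (trM r + y)) * m + of_real (y^2 + trM r * y + minM r) = 0 \<Longrightarrow> cmod m < y"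
    using dominating_root_exists assms(1,2) by blast
  then have "dominating_eigenvalue (M132J r) (of_real (- y))" using dominating_of_root by blast
  then have "complex_of_real l = of_real (- y)" using assms(3) dominating_eigenvalue_unique by blast
  then have l: "l = - y" using of_real_eq_iff by blast
  show "l < 0" "qM r (- l) = 0" "r^11 < (- l)^3" using y by (simp_all add: l)
  show "cmod m < - l" if "m^2 + of_real (- (trM r - l)) * m + of_real (l^2 - trM r * l + minM r) = 0" for m
    using that y(4)[of m] by (simp add: l)
qed

lemma qM_root_le_dominating:
  assumes "dominating_eigenvalue (M132J r) (of_real (- y))" "qM r z = 0" "0 < z" "0 < y"
  shows "z \<le> y"
proof (cases "z = y")
  case False
  have "eigenvalue (map_matrix complex_of_real (M132J r)) (of_real (- z))"
    unfolding eigenvalue_M132J_complex charpoly_factor[OF assms(2)] by simp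
  moreover have "complex_of_real (- z) \<noteq> of_real (- y)" using False of_real_eq_iff by (metis neg_equal_iff_equal)
  ultimately have "cmod (of_real (- z)) < cmod (of_real (- y))"
    using assms(1) unfolding dominating_eigenvalue_def by blast
  then show ?thesis using assms by simp
qed simp

text \<open>The sum of the two smaller eigenvalues is \<open>t + y\<close>. When \<open>t < 0\<close>, the polynomial \<open>q\<close> is negative at \<open>- t\<close>,
so it has a root above \<open>- t\<close>.\<close>

lemma trace_plus_root_pos:
  assumes r: "22/100 \<le> r" "r < 1" and dom: "dominating_eigenvalue (M132J r) (of_real (- y))" "0 < y"
  shows "0 < trM r + y"
proof (cases "0 \<le> trM r")
  case False
  have "qM r (- trM r) = - (trM r * minM r + r^11)"
    by (simp add: qM_def power2_eq_square power3_eq_cube)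
  then have "qM r (- trM r) < 0" using trace_minors_bound[OF r] by linarith
  from qM_root_above[OF this] False obtain z where "- trM r < z" "qM r z = 0" by auto
  moreover from this have "z \<le> y" using False dom qM_root_le_dominating by simp
  ultimately show ?thesis by simp
qed (use dom in simp)

text \<open>The cofactor \<open>z\<^sup>2 + (t + y) z + r\<^sup>1\<^sup>1 / y\<close> of \<open>z - y\<close> in \<open>q(z)\<close> is positive for \<open>z > 0\<close>.\<close>

lemma qM_sign:
  assumes "0 \<le> r" "0 < y" "qM r y = 0" "0 < trM r + y" "0 < z"
  shows "qM r z < 0 \<longleftrightarrow> z < y" "qM r z = 0 \<longleftrightarrow> z = y" "0 < qM r z \<longleftrightarrow> y < z"
proof -
  have "(y^2 + trM r * y + minM r) * y = r^11"
    using assms by (simp add: qM_def power2_eq_square power3_eq_cube algebra_simps)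
  then have "0 \<le> (y^2 + trM r * y + minM r) * y" using assms by simp
  then have "0 \<le> y^2 + trM r * y + minM r"
    using \<open>0 < y\<close> by (simp add: zero_le_mult_iff)
  then have pos: "0 < z^2 + (trM r + y) * z + (y^2 + trM r * y + minM r)"
    using assms by (intro add_pos_nonneg) auto
  show "qM r z < 0 \<longleftrightarrow> z < y" "qM r z = 0 \<longleftrightarrow> z = y" "0 < qM r z \<longleftrightarrow> y < z"
    unfolding qM_factor[OF assms(3)] using pos
    by (auto simp: mult_less_0_iff zero_less_mult_iff)
qed

lemma eigenvalue_M132J_real: "eigenvalue (M132J r) x \<longleftrightarrow> qM r (- x) = 0"
proof -
  have "det (M132J r - mat x) = qM r (- x)"
    by (simp add: det_minus_mat3 trace3_M132J minors3_M132J det_M132J qM_def)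
  then show ?thesis by (simp add: eigenvalue_iff_det)
qed

section \<open>Eigenvectors in coordinates adapted to the domains\<close>

text \<open>This is \<open>\<alpha>\<^sup>2 - r\<close>.\<close>

definition beta :: "real \<Rightarrow> real" where
  "beta r = (1 - r)^2 / 4"

text \<open>Positive exactly on the side of the first switching plane where $P_1$ acts.\<close>

definition gap :: "real^3 \<Rightarrow> real \<Rightarrow> real" where
  "gap u r = alpha r * u $ 2 - u $ 1"

text \<open>The determinant of the linear system \<open>eigen_eqs\<close> for the third coordinate and the gap of an eigenvector
in terms of its first coordinate.\<close>

definition elim_det :: "real \<Rightarrow> real \<Rightarrow> real" where
  "elim_det r y = y^2 + (2*r^4 - r^3 * beta r + r * (beta r)^2 - 3 * r^2 * (beta r)^2 - 2 * (beta r)^3) * y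
     + r^5 * (r^3 - r^2 * beta r + (beta r)^2 - r * (beta r)^2 + 2 * (beta r)^3)"

text \<open>In terms of \<open>u\<^sub>1\<close>, \<open>u\<^sub>3\<close> and the gap, the entries of \<open>M\<close> become short expressions in \<open>r\<close> and
\<open>\<beta>\<close>. The identities of this kind are proved by expressing everything through \<open>\<alpha>\<close>.\<close>

lemma M132J_third:
  "(M132J r *v u) $ 3 = r^2 * (r^2 - (beta r)^2) * u $ 3 + r^2 * beta r * u $ 1
     - r * beta r * (r^2 + beta r) * gap u r"
proof -
  define a where "a = alpha r"
  have a: "r = 2 * a - 1" "alpha r = a" by (simp_all add: a_def alpha_def field_simps)
  have b: "beta r = (1 - a)^2" by (simp add: beta_def a power2_eq_square field_simps)
  show ?thesis
    unfolding M132J_vec P_vec gap_def b a(2) by (simp only: a(1)) algebra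
qed

lemma gap_M132J:
  "gap (M132J r *v u) r = (r^4 - r^3 * beta r + r * (beta r)^2 - 2 * r^2 * (beta r)^2 - 2 * (beta r)^3) * gap u r
     - beta r * r * (r - 2 * beta r) * u $ 1
     + beta r * (r^2 * beta r + 2 * r * (r^2 - (beta r)^2)) * u $ 3"
proof -
  define a where "a = alpha r"
  have a: "r = 2 * a - 1" "alpha r = a" by (simp_all add: a_def alpha_def field_simps)
  have b: "beta r = (1 - a)^2" by (simp add: beta_def a power2_eq_square field_simps)
  show ?thesis
    unfolding gap_def M132J_vec P_vec b a(2) by (simp only: a(1)) algebra
qed

lemma P3_P1_third:
  "(P3 r *v (P1 r *v u)) $ 3 = r * (beta r * gap u r - r * u $ 1 + r * beta r * u $ 3)"
proof -
  define a where "a = alpha r"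
  have a: "r = 2 * a - 1" "alpha r = a" by (simp_all add: a_def alpha_def field_simps)
  have b: "beta r = (1 - a)^2" by (simp add: beta_def a power2_eq_square field_simps)
  show ?thesis
    unfolding gap_def P_vec b a(2) by (simp only: a(1)) algebra
qed

context
  fixes r y :: real and u :: "real^3"
  assumes eig: "M132J r *v u = (- y) *s u"
begin

lemma eigen_eqs:
  "(y + r^2 * (r^2 - (beta r)^2)) * u $ 3 = - (r^2) * beta r * u $ 1 + r * beta r * (r^2 + beta r) * gap u r"
  "(y + (r^4 - r^3 * beta r + r * (beta r)^2 - 2 * r^2 * (beta r)^2 - 2 * (beta r)^3)) * gap u r =
     beta r * r * (r - 2 * beta r) * u $ 1 - beta r * (r^2 * beta r + 2 * r * (r^2 - (beta r)^2)) * u $ 3"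
proof -
  have "(M132J r *v u) $ 3 = - y * u $ 3" "gap (M132J r *v u) r = - y * gap u r"
    by (simp_all add: eig gap_def algebra_simps)
  then show "(y + r^2 * (r^2 - (beta r)^2)) * u $ 3 = - (r^2) * beta r * u $ 1 + r * beta r * (r^2 + beta r) * gap u r"
    "(y + (r^4 - r^3 * beta r + r * (beta r)^2 - 2 * r^2 * (beta r)^2 - 2 * (beta r)^3)) * gap u r =
     beta r * r * (r - 2 * beta r) * u $ 1 - beta r * (r^2 * beta r + 2 * r * (r^2 - (beta r)^2)) * u $ 3"
    unfolding M132J_third gap_M132J by (simp_all add: algebra_simps)
qed

text \<open>Cramer's rule for the system above: the right-hand sides collapse to linear functions of \<open>y\<close>.\<close>

lemma eigen_third: "elim_det r y * u $ 3 = - (r^2) * beta r * (y + r^3 * (r - 2 * beta r)) * u $ 1"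
  using eigen_eqs unfolding elim_det_def by algebra

lemma eigen_gap: "elim_det r y * gap u r = r * beta r * ((r - 2 * beta r) * y + r^5) * u $ 1"
  using eigen_eqs unfolding elim_det_def by algebra

text \<open>The constant term collapses to \<open>r\<^sup>7 (r - \<beta>)\<close>, so the sign is evident once \<open>\<beta> < r\<close>.\<close>

lemma eigen_P3_P1_third:
  "elim_det r y * (P3 r *v (P1 r *v u)) $ 3 =
     - (r^2) * (y^2 + r^2 * (2 * r^2 - r * beta r - 2 * (beta r)^2) * y + r^7 * (r - beta r)) * u $ 1"
proof -
  have "elim_det r y * (P3 r *v (P1 r *v u)) $ 3 =
    r * (beta r * (elim_det r y * gap u r) - r * (elim_det r y * u $ 1) + r * beta r * (elim_det r y * u $ 3))"
    by (simp add: P3_P1_third algebra_simps)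
  also have "\<dots> = - (r^2) * (y^2 + r^2 * (2 * r^2 - r * beta r - 2 * (beta r)^2) * y + r^7 * (r - beta r)) * u $ 1"
    unfolding eigen_third eigen_gap unfolding elim_det_def by algebra
  finally show ?thesis .
qed

text \<open>Eliminating the first coordinate from the two equations gives the relation times \<open>\<beta> u\<^sub>3\<close>, and \<open>u\<^sub>3 = 0\<close>
would force the eigenvector to vanish. Arguing this way avoids dividing by \<open>elim_det\<close>, whose sign is known
only for larger \<open>r\<close>.\<close>

lemma gap_zero_imp:
  assumes "gap u r = 0" "u \<noteq> 0" "0 < r" "r < 1"
  shows "y * (2 * beta r - r) = r^5"
proof -
  have ba: "beta r \<noteq> 0" and al: "alpha r \<noteq> 0" using assms by (simp_all add: beta_def alpha_def)
  have "((r - 2 * beta r) * y + r^5) * u $ 3 * beta r = 0"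
    using eigen_eqs unfolding \<open>gap u r = 0\<close> by algebra
  moreover have "u $ 3 \<noteq> 0"
  proof
    assume "u $ 3 = 0"
    then have "u $ 1 = 0" using eigen_eqs(1) assms ba by simp
    then have "u $ 2 = 0" using assms(1) al by (simp add: gap_def)
    with \<open>u $ 1 = 0\<close> \<open>u $ 3 = 0\<close> show False using assms by (simp add: vec_eq_iff forall_3)
  qed
  ultimately have "(r - 2 * beta r) * y + r^5 = 0" using ba by simp
  then show ?thesis by (simp add: algebra_simps)
qed

end

definition crit_poly :: "real \<Rightarrow> real" where
  "crit_poly r = 5 - 22 * r - 2 * r^2 - 6 * r^3 + r^4"

text \<open>The product is computed from the four values \<open>y g = r\<^sup>5\<close>, \<open>2 g\<close>, \<open>32 t\<close> and \<open>32 s\<close>, where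
\<open>g = 2\<beta> - r\<close>.\<close>

lemma qM_at_critical:
  assumes "y * (2 * beta r - r) = r^5"
  shows "128 * (qM r y * (2 * beta r - r)^3) = r^10 * (1 - r)^4 * (1 - 6*r + r^2) * crit_poly r"
proof -
  define g where "g = 2 * beta r - r"
  have yg: "y * g = r^5" using assms by (simp add: g_def)
  have g: "2 * g = 1 - 4*r + r^2" by (simp add: g_def beta_def power2_eq_square field_simps)
  have t: "32 * trM r = -1 + 8*r - 21*r^2 + 29*r^4 + 24*r^5 - 7*r^6" by (simp add: trM_def)
  have s: "32 * minM r = r^5 * (7 - 24*r - 29*r^2 + 21*r^4 - 8*r^5 + r^6)" by (simp add: minM_def)
  have "qM r y * g^3 = (y*g)^3 + trM r * (y*g)^2 * g + minM r * (y*g) * g^2 - r^11 * g^3"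
    by (simp add: qM_def algebra_simps power2_eq_square power3_eq_cube)
  also have "\<dots> = r^15 + trM r * r^10 * g + minM r * r^5 * g^2 - r^11 * g^3"
    by (simp add: yg flip: power_mult)
  finally have q: "qM r y * g^3 = r^15 + trM r * r^10 * g + minM r * r^5 * g^2 - r^11 * g^3" .
  have "128 * (r^15 + trM r * r^10 * g + minM r * r^5 * g^2 - r^11 * g^3) =
     r^10 * (128 * r^5 + 2 * (32 * trM r) * (2 * g)) + r^5 * (32 * minM r) * (2*g)^2 - 16 * r^11 * (2*g)^3"
    by (simp add: power_mult_distrib algebra_simps flip: power_add)
  also have "\<dots> = r^10 * (1 - r)^4 * (1 - 6*r + r^2) * crit_poly r"
    unfolding g t s crit_poly_def by algebra
  finally show ?thesis using q by (simp add: g_def)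
qed

lemma crit_poly_antimono:
  assumes "0 \<le> x" "x < y" "y \<le> 1"
  shows "crit_poly y < crit_poly x"
proof -
  define S T where "S = x^2 + x*y + y^2" and "T = (x + y) * (x^2 + y^2)"
  have "crit_poly x - crit_poly y = (y - x) * (22 + 2 * (x + y) + 6 * S - T)"
    unfolding crit_poly_def S_def T_def by algebra
  moreover have "T \<le> 2 * 2" unfolding T_def
    using assms by (intro mult_mono add_mono order_trans[OF add_mono[OF power_le_one power_le_one]]) auto
  moreover have "0 \<le> S" using assms by (simp add: S_def)
  ultimately have "0 < crit_poly x - crit_poly y" using assms by simp
  then show ?thesis by simp
qed

text \<open>The root is $0.2200697861463104752050439\ldots$; the lower end is exactly half a unit of the twentieth
decimal below the upper one.\<close>

lemma crit_root_exists:
  obtains rc where "crit_poly rc = 0" "0.220069786146310475205 < rc" "rc < 0.22006978614631047521"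
proof -
  define lo hi :: real where "lo = 0.220069786146310475205" and "hi = 0.22006978614631047521"
  have sg: "0 < crit_poly lo" "crit_poly hi < 0"
    by (simp_all add: crit_poly_def lo_def hi_def power_numeral_reduce)
  have "lo \<le> hi" by (simp add: lo_def hi_def)
  moreover have "continuous_on {lo..hi} crit_poly"
    unfolding crit_poly_def by (intro continuous_intros)
  ultimately obtain rc where rc: "crit_poly rc = 0" "lo \<le> rc" "rc \<le> hi"
    using IVT2'[of crit_poly hi 0 lo] sg by auto
  then have "lo \<noteq> rc" "rc \<noteq> hi" using sg by auto
  then show ?thesis using that rc unfolding lo_def hi_def by simp
qed

text \<open>Together with \<open>qM_sign\<close> this says that the dominating root exceeds \<open>r\<^sup>4\<close>, a bound that is simple
enough for all the remaining sign checks.\<close>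

lemma qM_r4_neg:
  assumes "22/100 \<le> r" "r < 1"
  shows "qM r (r^4) < 0"
proof -
  have "32 * qM r (r^4) = r^8 * (1 - r) * (1 + r)^2 * (1 - 6*r + r^2) * (-1 + 10*r - r^2)"
    unfolding qM_def trM_def minM_def by (simp add: power_numeral_reduce field_simps)
  moreover have "r^2 \<le> 1 * r" unfolding power2_eq_square using assms by (intro mult_right_mono) auto
  moreover have "1 - 6*r + r^2 < 0" "0 < -1 + 10*r - r^2" using assms calculation(2) by linarith+
  moreover have "0 < r^8 * (1 - r) * (1 + r)^2" using assms by simp
  ultimately have "32 * qM r (r^4) < 0" by (simp only: mult_pos_neg mult_neg_pos)
  then show ?thesis by simp
qed

lemma beta_less:
  assumes "22/100 \<le> r" "r < 1"
  shows "beta r < r" "0 < beta r"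
proof -
  have "r^2 \<le> 1 * r" unfolding power2_eq_square using assms by (intro mult_right_mono) auto
  moreover have "4 * beta r = 1 - 2 * r + r^2" by (simp add: beta_def power2_eq_square field_simps)
  ultimately show "beta r < r" using assms by linarith
  show "0 < beta r" using assms by (simp add: beta_def)
qed

lemma elim_det_linear_pos:
  assumes "22/100 \<le> r" "r \<le> 1"
  shows "0 < r^4 + (2*r^4 - r^3 * beta r + r * (beta r)^2 - 3 * r^2 * (beta r)^2 - 2 * (beta r)^3)"
proof -
  have "0 < poly_val [-1, 8, -29, 48, 53, 24, -7] r"
    by (rule pos_on_grid[where a="0.22" and bs="[1]"]) (use assms in \<open>simp_all add: min_def\<close>)
  also have "\<dots> = 32 * (r^4 + (2*r^4 - r^3 * beta r + r * (beta r)^2 - 3 * r^2 * (beta r)^2 - 2 * (beta r)^3))"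
    by (simp add: poly_val_simps beta_def power_numeral_reduce field_simps)
  finally show ?thesis by simp
qed

lemma P3_P1_third_linear_pos:
  assumes "22/100 \<le> r" "r \<le> 1"
  shows "0 < 2 * r^2 - r * beta r - 2 * (beta r)^2"
proof -
  have "0 < poly_val [-1, 2, 14, 2, -1] r"
    by (rule pos_on_grid[where a="0.22" and bs="[1]"]) (use assms in \<open>simp_all add: min_def\<close>)
  also have "\<dots> = 8 * (2 * r^2 - r * beta r - 2 * (beta r)^2)"
    by (simp add: poly_val_simps beta_def power_numeral_reduce field_simps)
  finally show ?thesis by simp
qed

text \<open>The three factors that determine the signs of \<open>u\<^sub>3\<close> and of the third coordinate of \<open>P\<^sub>3 P\<^sub>1 u\<close>
relative to \<open>u\<^sub>1\<close>.\<close>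

lemma eigen_signs:
  assumes r: "22/100 \<le> r" "r < 1" and y: "r^4 < y"
  shows "0 < elim_det r y" "0 < y + r^3 * (r - 2 * beta r)"
    "0 < y^2 + r^2 * (2 * r^2 - r * beta r - 2 * (beta r)^2) * y + r^7 * (r - beta r)"
proof -
  note b = beta_less[OF r]
  have "0 < r^4" using r by simp
  then have y0: "0 < y" using y by linarith
  define k where "k = 2*r^4 - r^3 * beta r + r * (beta r)^2 - 3 * r^2 * (beta r)^2 - 2 * (beta r)^3"
  have "0 < y + k" using elim_det_linear_pos r y unfolding k_def by fastforce
  then have "0 < (y + k) * y" using y0 by simp
  moreover have "0 \<le> r^5 * (r^2 * (r - beta r) + (beta r)^2 * (1 - r) + 2 * (beta r)^3)"
    using r b by (intro mult_nonneg_nonneg add_nonneg_nonneg) auto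
  moreover have "elim_det r y = (y + k) * y + r^5 * (r^2 * (r - beta r) + (beta r)^2 * (1 - r) + 2 * (beta r)^3)"
    unfolding elim_det_def k_def by algebra
  ultimately show "0 < elim_det r y" by linarith
  have "0 \<le> r^3 * (2 * (r - beta r))" using r b by simp
  also have "r^3 * (2 * (r - beta r)) = r^4 + r^3 * (r - 2 * beta r)" by algebra
  finally show "0 < y + r^3 * (r - 2 * beta r)" using y by linarith
  show "0 < y^2 + r^2 * (2 * r^2 - r * beta r - 2 * (beta r)^2) * y + r^7 * (r - beta r)"
    using P3_P1_third_linear_pos[of r] r b y0 by (intro add_pos_pos mult_pos_pos) auto
qed

section \<open>Itineraries and the reversal symmetry\<close>

text \<open>The open cone over \<open>P_domain r i\<close>. Working with rays instead of unit vectors keeps the dynamics linear.\<close>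

definition branch_cone :: "real \<Rightarrow> nat \<Rightarrow> (real^3) set" where
  "branch_cone r i = {x. 0 < x $ 1 \<and> x $ 3 < 0 \<and>
     ((i = 1 \<and> 0 < alpha r * x $ 2 - x $ 1) \<or>
      (i = 3 \<and> alpha r * x $ 2 - x $ 3 < 0) \<or>
      (i = 2 \<and> alpha r * x $ 2 - x $ 1 < 0 \<and> 0 < alpha r * x $ 2 - x $ 3))}"

text \<open>The last alternative stands for \<open>i = 2\<close>, as \<open>branch_cone r i\<close> is empty unless \<open>i\<close> is 1, 2 or 3.\<close>

definition branch :: "real \<Rightarrow> nat \<Rightarrow> real^3^3" where
  "branch r i = (if i = 1 then P1 r else if i = 3 then P3 r else P2 r)"

definition orbit_vec :: "real \<Rightarrow> nat list \<Rightarrow> real^3 \<Rightarrow> real^3" where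
  "orbit_vec r w x = foldl (\<lambda>x i. branch r i *v x) x w"

lemma normalize_in_P_domain:
  assumes "x \<noteq> 0"
  shows "normalize_vec x \<in> P_domain r i \<longleftrightarrow> x \<in> branch_cone r i"
proof -
  have n: "0 < norm x" using assms by simp
  have lin: "alpha r * (x $ j / norm x) - x $ k / norm x = (alpha r * x $ j - x $ k) / norm x" for j k
    by (simp add: diff_divide_distrib)
  have "norm (x /\<^sub>R norm x) = 1" using n by simp
  moreover have "(x /\<^sub>R norm x) $ j = x $ j / norm x" for j by (simp add: divide_inverse mult.commute)
  ultimately show ?thesis
    unfolding P_domain_def phase_space_def branch_cone_def normalize_vec_def
    using n by (simp add: lin zero_less_divide_iff divide_less_0_iff divide_less_cancel)
qed

lemma cone_nonzero: "x \<in> branch_cone r i \<Longrightarrow> x \<noteq> 0"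
  by (auto simp: branch_cone_def)

lemma cone_2_3_disjoint: "x \<in> branch_cone r 2 \<Longrightarrow> x \<notin> branch_cone r 3" "x \<in> branch_cone r 3 \<Longrightarrow> x \<notin> branch_cone r 1"
  unfolding branch_cone_def by auto

lemma branch_nonzero:
  assumes "0 < r" "x \<in> branch_cone r i"
  shows "branch r i *v x \<noteq> 0"
proof -
  have "(branch r i *v x) $ 1 > 0"
    using assms by (auto simp: branch_cone_def branch_def P_vec)
  then show ?thesis by auto
qed

lemma normalize_vec_scale:
  assumes "0 < c"
  shows "normalize_vec (c *\<^sub>R x) = normalize_vec x"
  using assms by (simp add: normalize_vec_def)

lemma normalize_mult_normalize:
  fixes A :: "real^3^3"
  assumes "x \<noteq> 0"
  shows "normalize_vec (A *v normalize_vec x) = normalize_vec (A *v x)"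
proof -
  have "A *v normalize_vec x = inverse (norm x) *\<^sub>R (A *v x)"
    by (simp add: normalize_vec_def matrix_vector_mult_scaleR)
  then show ?thesis using assms by (simp add: normalize_vec_scale)
qed

lemma bb_map_ray:
  assumes "x \<in> branch_cone r i"
  shows "bb_map r (normalize_vec x) = Some (normalize_vec (branch r i *v x))"
proof -
  note n = normalize_in_P_domain[OF cone_nonzero[OF assms]] normalize_mult_normalize[OF cone_nonzero[OF assms]]
  consider "i = 1" | "i = 3" | "i = 2" using assms by (auto simp: branch_cone_def)
  then show ?thesis
  proof cases
    case 1
    then show ?thesis using assms by (simp add: bb_map_def n branch_def)
  next
    case 2
    then show ?thesis using assms cone_2_3_disjoint by (simp add: bb_map_def n branch_def)
  next
    case 3
    moreover have "x \<notin> branch_cone r 1" using assms 3 by (auto simp: branch_cone_def)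
    ultimately show ?thesis using assms cone_2_3_disjoint by (simp add: bb_map_def n branch_def)
  qed
qed

lemma orbit_vec_take_Suc:
  "k < length w \<Longrightarrow> orbit_vec r (take (Suc k) w) x = branch r (w ! k) *v orbit_vec r (take k w) x"
  by (simp add: orbit_vec_def take_Suc_conv_app_nth)

lemma piter_path:
  assumes "\<forall>j<length w. orbit_vec r (take j w) x \<in> branch_cone r (w ! j)" "k \<le> length w"
  shows "piter (bb_map r) k (normalize_vec x) = Some (normalize_vec (orbit_vec r (take k w) x))"
  using assms(2)
proof (induction k)
  case (Suc k)
  then show ?case using assms(1) by (simp add: orbit_vec_take_Suc bb_map_ray)
qed (simp add: orbit_vec_def)

text \<open>Normalization commutes with the linear branches up to positive factors, so an itinerary can be read off
from the unnormalized products.\<close>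

lemma generates_orbit_iff:
  assumes "0 < r" "w \<noteq> []"
  shows "generates_orbit r w q \<longleftrightarrow> norm q = 1 \<and>
     (\<forall>j<length w. orbit_vec r (take j w) q \<in> branch_cone r (w ! j)) \<and> normalize_vec (orbit_vec r w q) = q"
    (is "?L \<longleftrightarrow> ?R")
proof
  assume L: ?L
  have dom: "v \<in> P_domain r (w ! j)" if "j < length w" "piter (bb_map r) j q = Some v" for j v
    using L that unfolding generates_orbit_def by force
  have q: "norm q = 1" using dom[of 0 q] assms(2) by (simp add: P_domain_def phase_space_def)
  then have nq: "normalize_vec q = q" by (simp add: normalize_vec_def)
  have "piter (bb_map r) k q = Some (normalize_vec (orbit_vec r (take k w) q)) \<and> orbit_vec r (take k w) q \<noteq> 0 \<and>
     (\<forall>j<k. orbit_vec r (take j w) q \<in> branch_cone r (w ! j))" if "k \<le> length w" for k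
    using that
  proof (induction k)
    case 0
    then show ?case using q by (auto simp: orbit_vec_def nq)
  next
    case (Suc k)
    then have k: "k < length w" by simp
    with Suc.IH have IH: "piter (bb_map r) k q = Some (normalize_vec (orbit_vec r (take k w) q))"
      "orbit_vec r (take k w) q \<noteq> 0" "\<forall>j<k. orbit_vec r (take j w) q \<in> branch_cone r (w ! j)" by auto
    have c: "orbit_vec r (take k w) q \<in> branch_cone r (w ! k)"
      using dom[OF k IH(1)] normalize_in_P_domain[OF IH(2)] by simp
    then show ?case
      using IH k branch_nonzero[OF assms(1) c] by (simp add: orbit_vec_take_Suc bb_map_ray less_Suc_eq)
  qed
  from this[of "length w"] show ?R using q L unfolding generates_orbit_def by simp
next
  assume R: ?R
  then have nq: "normalize_vec q = q" by (simp add: normalize_vec_def)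
  have p: "piter (bb_map r) k q = Some (normalize_vec (orbit_vec r (take k w) q))" if "k \<le> length w" for k
    using piter_path[of w r q k] R that by (simp add: nq)
  have "\<exists>v. piter (bb_map r) j q = Some v \<and> v \<in> P_domain r (w ! j)" if "j < length w" for j
    using p[of j] that R normalize_in_P_domain cone_nonzero by auto
  then show ?L using p[of "length w"] R unfolding generates_orbit_def by simp
qed

text \<open>By \<open>half_orbit_iff\<close> these are the points that can follow $132$. The conditions on the second coordinates
at the third step appear here as conditions on \<open>M x\<close>, whose outer coordinates are, up to the factor
\<open>r > 0\<close>, the expressions that define the domain of $P_2$.\<close>

definition half_orbit :: "real \<Rightarrow> (real^3) set" where
  "half_orbit r = {x. 0 < x $ 1 \<and> x $ 3 < 0 \<and> 0 < gap x r \<and>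
     (P3 r *v (P1 r *v x)) $ 3 < 0 \<and> 0 < (M132J r *v x) $ 3 \<and> (M132J r *v x) $ 1 < 0}"

lemma half_orbit_iff:
  assumes "0 < r"
  shows "x \<in> half_orbit r \<longleftrightarrow>
     x \<in> branch_cone r 1 \<and> P1 r *v x \<in> branch_cone r 3 \<and> P3 r *v (P1 r *v x) \<in> branch_cone r 2"
proof -
  define v w where "v = P1 r *v x" and "w = P3 r *v v"
  have v: "v $ 1 = r * gap x r" "v $ 3 = r\<^sup>2 * x $ 3" by (simp_all add: v_def P_vec gap_def)
  have w: "w $ 1 = r\<^sup>2 * v $ 1" "w $ 3 = r * (alpha r * v $ 2 - v $ 3)" by (simp_all add: w_def P_vec)
  have M: "(M132J r *v x) $ 3 = r * (w $ 1 - alpha r * w $ 2)" "(M132J r *v x) $ 1 = r * (w $ 3 - alpha r * w $ 2)"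
    unfolding M132J_vec P_vec v_def w_def by simp_all
  show ?thesis
    unfolding half_orbit_def branch_cone_def mem_Collect_eq v_def[symmetric] w_def[symmetric] M
    using assms by (auto simp: v w zero_less_mult_iff mult_less_0_iff gap_def)
qed

lemma J_swap:
  "P3 r *v (J *v x) = J *v (P1 r *v x)"
  "P1 r *v (J *v x) = J *v (P3 r *v x)"
  "P2 r *v (J *v x) = J *v (P2 r *v x)"
  by (simp_all add: vec_eq_iff forall_3 P_vec algebra_simps)

text \<open>The reversal \<open>x \<mapsto> - J x\<close> permutes the domains.\<close>

lemma cone_swap:
  "J *v x \<in> branch_cone r 3 \<longleftrightarrow> - x \<in> branch_cone r 1"
  "J *v x \<in> branch_cone r 1 \<longleftrightarrow> - x \<in> branch_cone r 3"
  "J *v x \<in> branch_cone r 2 \<longleftrightarrow> - x \<in> branch_cone r 2"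
  by (auto simp: branch_cone_def P_vec)

lemma J_J: "J *v (J *v x) = x"
  by (simp add: vec_eq_iff forall_3 P_vec)

lemma P2_P3_P1: "P2 r *v (P3 r *v (P1 r *v x)) = J *v (M132J r *v x)"
  by (simp add: M132J_vec J_J)

lemma matrix_vector_mult_minus: "(A :: real^3^3) *v (- x) = - (A *v x)"
  by (simp add: vec_eq_iff matrix_vector_mult_def sum_negf)

lemma path_in_cones_Cons:
  "(\<forall>j<length (i # w). orbit_vec r (take j (i # w)) x \<in> branch_cone r ((i # w) ! j)) \<longleftrightarrow>
     x \<in> branch_cone r i \<and> (\<forall>j<length w. orbit_vec r (take j w) (branch r i *v x) \<in> branch_cone r (w ! j))"
  by (simp add: All_less_Suc2 orbit_vec_def)

text \<open>After three steps the point is \<open>J M x\<close>, the mirror image of \<open>- M x\<close>, and by the symmetry its itinerary $312$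
is the itinerary $132$ of \<open>- M x\<close>.\<close>

lemma orbit_132312_path:
  assumes "0 < r"
  shows "(\<forall>j<length [1::nat, 3, 2, 3, 1, 2]. orbit_vec r (take j [1, 3, 2, 3, 1, 2]) x
        \<in> branch_cone r ([1, 3, 2, 3, 1, 2] ! j)) \<longleftrightarrow>
      x \<in> half_orbit r \<and> - (M132J r *v x) \<in> half_orbit r" (is "?cones \<longleftrightarrow> _")
    and "orbit_vec r [1, 3, 2, 3, 1, 2] x = M132J r *v (M132J r *v x)"
proof -
  define z where "z = M132J r *v x"
  have 1: "P2 r *v (P3 r *v (P1 r *v x)) = J *v z" by (simp add: P2_P3_P1 z_def)
  have 2: "P2 r *v (P1 r *v (P3 r *v (J *v z))) = M132J r *v z" by (simp add: J_swap P2_P3_P1 J_J)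
  show "orbit_vec r [1, 3, 2, 3, 1, 2] x = M132J r *v (M132J r *v x)"
    by (simp add: orbit_vec_def branch_def 1 2) (simp add: z_def)
  have "?cones \<longleftrightarrow>
     (x \<in> branch_cone r 1 \<and> P1 r *v x \<in> branch_cone r 3 \<and> P3 r *v (P1 r *v x) \<in> branch_cone r 2) \<and>
     (J *v z \<in> branch_cone r 3 \<and> P3 r *v (J *v z) \<in> branch_cone r 1 \<and> P1 r *v (P3 r *v (J *v z)) \<in> branch_cone r 2)"
    unfolding path_in_cones_Cons by (simp add: branch_def 1)
  also have "(J *v z \<in> branch_cone r 3 \<and> P3 r *v (J *v z) \<in> branch_cone r 1 \<and> P1 r *v (P3 r *v (J *v z)) \<in> branch_cone r 2) \<longleftrightarrow>
     - z \<in> half_orbit r"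
    by (simp add: half_orbit_iff[OF assms] J_swap cone_swap matrix_vector_mult_minus del: One_nat_def)
  finally show "?cones \<longleftrightarrow> x \<in> half_orbit r \<and> - (M132J r *v x) \<in> half_orbit r"
    unfolding half_orbit_iff[OF assms, of x] z_def by simp
qed

lemma orbit_132312:
  assumes "0 < r"
  shows "generates_orbit r [1, 3, 2, 3, 1, 2] q \<longleftrightarrow> norm q = 1 \<and>
     q \<in> half_orbit r \<and> - (M132J r *v q) \<in> half_orbit r \<and> normalize_vec (M132J r *v (M132J r *v q)) = q"
  unfolding generates_orbit_iff[OF assms list.distinct(2)] orbit_132312_path[OF assms] by simp

section \<open>Power boundedness of the normalized matrix\<close>

text \<open>The contraction by \<open>nu\<close> sums the perturbations as a geometric series.\<close>

lemma first_order_bounded: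
  fixes z :: "nat \<Rightarrow> complex"
  assumes nu: "cmod nu < 1" and step: "\<And>k. cmod (z (Suc k) - nu * z k) \<le> B"
  shows "cmod (z k) \<le> cmod (z 0) + B / (1 - cmod nu)"
proof (induction k)
  case 0
  have "0 \<le> B" using step[of 0] by (rule order_trans[OF norm_ge_zero])
  then show ?case using nu by simp
next
  case (Suc k)
  define D where "D = B / (1 - cmod nu)"
  have "(1 - cmod nu) * D = B" using nu by (simp add: D_def)
  then have D: "B = D - cmod nu * D" by (simp add: algebra_simps)
  have "cmod (z (Suc k)) \<le> B + cmod nu * cmod (z k)"
    using norm_triangle_ineq[of "z (Suc k) - nu * z k" "nu * z k"] step[of k] by (simp add: norm_mult)
  also have "cmod nu * cmod (z k) \<le> cmod nu * (cmod (z 0) + D)"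
    using Suc.IH by (intro mult_left_mono) (simp_all add: D_def)
  also have "B + cmod nu * (cmod (z 0) + D) = D + cmod nu * cmod (z 0)"
    by (subst D) (simp add: algebra_simps)
  also have "cmod nu * cmod (z 0) \<le> 1 * cmod (z 0)" using nu by (intro mult_right_mono) auto
  finally show ?case by (simp add: D_def add.commute)
qed

text \<open>The characteristic roots are \<open>1\<close>, \<open>a\<close>, \<open>b\<close>. Writing the shift as \<open>E\<close>, the sequence
\<open>f = (E - a) (E - b) x\<close> is constant; undoing the two factors one after the other keeps the bound.\<close>

lemma third_order_bounded:
  fixes x :: "nat \<Rightarrow> complex"
  assumes nu: "cmod a < 1" "cmod b < 1"
    and rec: "\<And>k. x (Suc (Suc (Suc k))) = (1 + a + b) * x (Suc (Suc k)) - (a + b + a * b) * x (Suc k) + a * b * x k"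
    and init: "cmod (x 0) \<le> H" "cmod (x (Suc 0)) \<le> H" "cmod (x (Suc (Suc 0))) \<le> H"
  shows "cmod (x k) \<le> (1 + (2 + 4 / (1 - cmod a)) / (1 - cmod b)) * H"
proof -
  define g where "g k = x (Suc k) - b * x k" for k
  define f where "f k = g (Suc k) - a * g k" for k
  have H: "0 \<le> H" using init(1) norm_ge_zero order_trans by blast
  have mul: "cmod (c * w) \<le> H" if "cmod c < 1" "cmod w \<le> H" for c w
    unfolding norm_mult using that H mult_mono[of "cmod c" 1 "cmod w" H] by simp
  have g: "cmod (g 0) \<le> 2 * H" "cmod (g (Suc 0)) \<le> 2 * H"
    unfolding g_def using init mul[OF nu(2)] norm_triangle_ineq4 by (smt (verit, best))+
  have "f (Suc k) = f k" for k by (simp add: f_def g_def rec algebra_simps)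
  then have fc: "f k = f 0" for k by (induction k) auto
  have "cmod (a * g 0) \<le> 2 * H"
    unfolding norm_mult using nu(1) g(1) mult_mono[of "cmod a" 1 "cmod (g 0)" "2 * H"] by simp
  then have f: "cmod (f 0) \<le> 4 * H"
    unfolding f_def using g norm_triangle_ineq4[of "g (Suc 0)" "a * g 0"] by linarith
  have "cmod (g k) \<le> cmod (g 0) + 4 * H / (1 - cmod a)" for k
    by (rule first_order_bounded[OF nu(1)]) (metis f fc f_def)
  then have "cmod (g k) \<le> (2 + 4 / (1 - cmod a)) * H" for k
    using g(1) by (simp add: distrib_right) (smt (verit, best))
  then have "cmod (x k) \<le> cmod (x 0) + (2 + 4 / (1 - cmod a)) * H / (1 - cmod b)"
    by (intro first_order_bounded[OF nu(2)]) (simp flip: g_def)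
  then show ?thesis using init(1) by (simp add: distrib_right)
qed

text \<open>By the Cayley-Hamilton theorem every coordinate of the orbit of \<open>h\<close> satisfies the recurrence of
\<open>third_order_bounded\<close>, here with characteristic roots the eigenvalues \<open>1\<close>, \<open>a\<close>, \<open>b\<close> of \<open>A\<close>. No Jordan
form is involved, so \<open>a\<close> and \<open>b\<close> may coincide or be complex.\<close>

lemma power_bounded3:
  fixes A :: "real^3^3" and a b :: complex
  assumes nu: "cmod a < 1" "cmod b < 1"
    and tr: "of_real (trace3 A) = 1 + a + b" and mi: "of_real (minors3 A) = a + b + a * b"
    and de: "of_real (det A) = a * b"
  obtains C where "0 \<le> C" "\<And>h k. norm (((*v) A ^^ k) h) \<le> C * norm h"
proof -
  obtain K0 where K0: "\<And>h. norm (A *v h) \<le> norm h * K0"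
    using bounded_linear.bounded[OF matrix_vector_mul_bounded_linear[of A]] by blast
  define K where "K = max 1 K0"
  have K: "1 \<le> K" "norm (A *v h) \<le> K * norm h" for h
    using K0[of h] mult_left_mono[of K0 K "norm h"] by (auto simp: K_def mult.commute)
  define C where "C = (1 + (2 + 4 / (1 - cmod a)) / (1 - cmod b)) * K^2"
  have C: "0 \<le> C" using nu by (simp add: C_def)
  have comp: "\<bar>((*v) A ^^ k) h $ i\<bar> \<le> C * norm h" for k h i
  proof -
    define x where "x k = complex_of_real (((*v) A ^^ k) h $ i)" for k
    have "cmod (x k) \<le> (1 + (2 + 4 / (1 - cmod a)) / (1 - cmod b)) * (K^2 * norm h)"
    proof (rule third_order_bounded[OF nu])
      fix k
      have "((*v) A ^^ Suc (Suc (Suc k))) h $ i = trace3 A * ((*v) A ^^ Suc (Suc k)) h $ i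
          - minors3 A * ((*v) A ^^ Suc k) h $ i + det A * ((*v) A ^^ k) h $ i"
        by (simp add: cayley_hamilton3)
      then show "x (Suc (Suc (Suc k))) = (1 + a + b) * x (Suc (Suc k)) - (a + b + a * b) * x (Suc k) + a * b * x k"
        unfolding x_def tr[symmetric] mi[symmetric] unfolding de[symmetric]
        by (simp flip: of_real_mult of_real_diff of_real_add)
    next
      have n1: "norm (A *v h) \<le> K * norm h" by (rule K(2))
      have "norm (A *v (A *v h)) \<le> K * norm (A *v h)" by (rule K(2))
      also have "\<dots> \<le> K * (K * norm h)" using n1 K(1) by (intro mult_left_mono) auto
      finally have n2: "norm (A *v (A *v h)) \<le> K * (K * norm h)" .
      have "1 * norm h \<le> K^2 * norm h" using K(1) by (intro mult_right_mono) (auto simp: one_le_power)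
      moreover have "K * norm h \<le> K^2 * norm h" using K(1) by (intro mult_right_mono) (auto simp: self_le_power)
      ultimately show "cmod (x 0) \<le> K^2 * norm h" "cmod (x (Suc 0)) \<le> K^2 * norm h" "cmod (x (Suc (Suc 0))) \<le> K^2 * norm h"
        using n1 n2 component_le_norm_cart[of h i] component_le_norm_cart[of "A *v h" i]
          component_le_norm_cart[of "A *v (A *v h)" i]
        by (simp_all add: x_def power2_eq_square mult.assoc)
    qed
    then show ?thesis by (simp add: x_def C_def mult.assoc)
  qed
  have "norm (((*v) A ^^ k) h) \<le> (3 * C) * norm h" for k h
  proof -
    have "norm (((*v) A ^^ k) h) \<le> (\<Sum>i\<in>UNIV. \<bar>((*v) A ^^ k) h $ i\<bar>)" by (rule norm_le_l1_cart)
    also have "\<dots> \<le> (\<Sum>i\<in>(UNIV :: 3 set). C * norm h)" by (intro sum_mono comp)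
    finally show ?thesis by simp
  qed
  with C show ?thesis using that[of "3 * C"] by auto
qed

lemma complex_quadratic_roots:
  fixes b c :: complex
  obtains m1 m2 where "b = - (m1 + m2)" "c = m1 * m2"
proof -
  define d where "d = csqrt (b^2 - 4 * c)"
  have "d^2 = b^2 - 4 * c" by (simp add: d_def)
  then have "b = - ((- b + d) / 2 + (- b - d) / 2)" "c = (- b + d) / 2 * ((- b - d) / 2)"
    by (simp_all add: power2_eq_square field_simps)
  then show ?thesis by (rule that)
qed

text \<open>Division by the dominating eigenvalue \<open>- y\<close> moves it to \<open>1\<close> and the others into the open unit disc.\<close>

lemma normalized_M132J_power_bounded:
  assumes r: "0 \<le> r" "r < 1" and dom: "dominating_eigenvalue (M132J r) (of_real (- y))"
  obtains C where "0 \<le> C" "\<And>h k. norm (((*v) ((- 1 / y) *\<^sub>R M132J r) ^^ k) h) \<le> C * norm h"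
proof -
  note d = dominating_real[OF r dom, simplified]
  obtain m1 m2 :: complex where m: "of_real (- (trM r + y)) = - (m1 + m2)"
    "of_real (y^2 + trM r * y + minM r) = m1 * m2"
    using complex_quadratic_roots by metis
  have "y \<noteq> 0" using d(1) by simp
  have lt: "cmod (- m1 / of_real y) < 1" "cmod (- m2 / of_real y) < 1"
  proof -
    have "m1^2 + of_real (- (trM r + y)) * m1 + of_real (y^2 + trM r * y + minM r) = 0"
      "m2^2 + of_real (- (trM r + y)) * m2 + of_real (y^2 + trM r * y + minM r) = 0"
      unfolding m by (simp_all add: power2_eq_square algebra_simps)
    then have "cmod m1 < y" "cmod m2 < y" using d(4) by simp_all
    then show "cmod (- m1 / of_real y) < 1" "cmod (- m2 / of_real y) < 1" using d(1) by (simp_all add: norm_divide)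
  qed
  let ?A = "(- 1 / y) *\<^sub>R M132J r"
  have A: "trace3 ?A = - trM r / y" "minors3 ?A = minM r / y^2" "det ?A = r^11 / y^3"
  proof -
    show "trace3 ?A = - trM r / y"
      by (simp add: trace3_M132J[symmetric] trace3_def add_divide_distrib diff_divide_distrib)
    show "minors3 ?A = minM r / y^2"
      by (simp add: minors3_M132J[symmetric] minors3_def add_divide_distrib diff_divide_distrib power2_eq_square)
    have "det ?A = - det (M132J r) / y^3"
      by (simp add: det_3 add_divide_distrib diff_divide_distrib power3_eq_cube)
    then show "det ?A = r^11 / y^3" by (simp add: det_M132J)
  qed
  have s: "complex_of_real (trM r) + of_real y = m1 + m2"
    using m(1) unfolding of_real_minus neg_equal_iff_equal by simp
  have c: "of_real y^2 + of_real (trM r) * of_real y + of_real (minM r) = m1 * m2" using m(2) by simp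
  have q: "complex_of_real (r^11) = of_real y * (of_real y^2 + of_real (trM r) * of_real y + of_real (minM r))"
    using d(2) by (simp add: qM_def power2_eq_square power3_eq_cube algebra_simps flip: of_real_power of_real_mult of_real_add)
  show ?thesis
  proof (rule power_bounded3[OF lt])
    show "complex_of_real (trace3 ?A) = 1 + - m1 / of_real y + - m2 / of_real y"
    proof -
      have m2: "m2 = complex_of_real (trM r) + of_real y - m1" by (simp add: s)
      show ?thesis unfolding A m2 using \<open>y \<noteq> 0\<close> by (simp add: field_simps)
    qed
    show "complex_of_real (minors3 ?A) = - m1 / of_real y + - m2 / of_real y + (- m1 / of_real y) * (- m2 / of_real y)"
    proof -
      have "complex_of_real (minM r) = m1 * m2 - of_real y * (m1 + m2)"
        unfolding c[symmetric] s[symmetric] by (simp add: power2_eq_square algebra_simps)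
      note mi = this
      show ?thesis unfolding A of_real_divide of_real_power mi
        using \<open>y \<noteq> 0\<close> by (simp add: field_simps power2_eq_square)
    qed
    show "complex_of_real (det ?A) = (- m1 / of_real y) * (- m2 / of_real y)"
    proof -
      have "complex_of_real (det ?A) = of_real (r^11) / of_real y^3" unfolding A by simp
      then show ?thesis unfolding q c using \<open>y \<noteq> 0\<close> by (simp add: power3_eq_cube)
    qed
  qed (use that in auto)
qed

section \<open>The periodic orbit\<close>

lemma half_orbit_scale:
  assumes "0 < c" "x \<in> half_orbit r"
  shows "c *\<^sub>R x \<in> half_orbit r"
proof -
  have "gap (c *\<^sub>R x) r = c * gap x r" by (simp add: gap_def algebra_simps)
  then show ?thesis
    using assms by (simp add: half_orbit_def matrix_vector_mult_scaleR mult_pos_neg mult_neg_pos)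
qed

lemma open_half_orbit: "open (half_orbit r)"
proof -
  have "continuous_on UNIV (\<lambda>x. (A *v x) $ i)" for A :: "real^3^3" and i
    by (intro continuous_intros matrix_vector_mult_linear_continuous_on)
  note c = this this[of "P3 r ** P1 r", unfolded matrix_vector_mul_assoc[symmetric]]
  show ?thesis unfolding half_orbit_def gap_def
    by (intro open_Collect_conj open_Collect_less continuous_intros c)
qed

context
  fixes r y :: real
  assumes r: "22/100 \<le> r" "r < 1" "crit_poly r < 0"
    and dom: "dominating_eigenvalue (M132J r) (of_real (- y))"
begin

lemma r_pos: "0 < r" "0 \<le> r" using r by simp_all

lemma dominating_root_facts: "0 < y" "qM r y = 0" "0 < trM r + y"
  using dominating_real[OF r_pos(2) r(2) dom] trace_plus_root_pos[OF r(1,2) dom] by simp_all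

lemma positive_root_iff: "0 < z \<Longrightarrow> qM r z = 0 \<longleftrightarrow> z = y"
  using qM_sign(2)[OF r_pos(2) dominating_root_facts] .

lemma r4_less: "r^4 < y"
  using qM_sign(1)[OF r_pos(2) dominating_root_facts, of "r^4"] qM_r4_neg[OF r(1,2)] r_pos by simp

text \<open>The only place where \<open>r\<close> has to exceed the critical parameter: for \<open>2\<beta> > r\<close> the claim is that \<open>y\<close> lies
below \<open>Y = r\<^sup>5 / (2\<beta> - r)\<close>, that is \<open>q(Y) > 0\<close>, and there both the quartic and \<open>1 - 6r + r\<^sup>2\<close> are negative.\<close>

lemma gap_coeff_pos: "0 < (r - 2 * beta r) * y + r^5"
proof (cases "2 * beta r \<le> r")
  case True
  then have "0 \<le> (r - 2 * beta r) * y" using dominating_root_facts by simp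
  moreover have "0 < r^5" using r_pos by simp
  ultimately show ?thesis by linarith
next
  case False
  define g where "g = 2 * beta r - r"
  define Y where "Y = r^5 / g"
  have g: "0 < g" using False by (simp add: g_def)
  then have Y: "Y * g = r^5" "0 < Y" using r_pos by (simp_all add: Y_def)
  have "r^2 \<le> 1 * r" unfolding power2_eq_square using r by (intro mult_right_mono) auto
  then have "1 - 6*r + r^2 < 0" using r by linarith
  then have "0 < (1 - 6*r + r^2) * crit_poly r" using r(3) by (rule mult_neg_neg)
  moreover have "0 < r^10 * (1 - r)^4" using r by simp
  ultimately have "0 < r^10 * (1 - r)^4 * ((1 - 6*r + r^2) * crit_poly r)" by (rule mult_pos_pos[rotated])
  also have "\<dots> = 128 * (qM r Y * g^3)"
    using qM_at_critical[of Y r] Y(1) unfolding g_def by (simp add: mult.assoc)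
  finally have "0 < qM r Y" using g by (simp add: zero_less_mult_iff)
  then have "y < Y" using qM_sign(3)[OF r_pos(2) dominating_root_facts Y(2)] by simp
  then have "y * g < r^5" using g by (simp flip: Y(1))
  then show ?thesis by (simp add: g_def algebra_simps)
qed

lemma dominating_eigenvector_first_nonzero:
  assumes v: "M132J r *v v = (- y) *s v" and "v \<noteq> 0"
  shows "v $ 1 \<noteq> 0"
proof
  assume 1: "v $ 1 = 0"
  then have "v $ 3 = 0" "gap v r = 0"
    using eigen_third[OF v] eigen_gap[OF v] eigen_signs(1)[OF r(1,2) r4_less] by simp_all
  then have "v = 0" using 1 r_pos by (simp add: vec_eq_iff forall_3 gap_def alpha_def)
  then show False using \<open>v \<noteq> 0\<close> by simp
qed

text \<open>An eigenvector is determined by its first coordinate, so the combination of \<open>v\<close> and \<open>w\<close> with vanishing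
first coordinate is zero.\<close>

lemma eigenspace_line:
  assumes v: "M132J r *v v = (- y) *s v" "v \<noteq> 0" and w: "M132J r *v w = (- y) *s w" "w \<noteq> 0"
  shows "v = (v $ 1 / w $ 1) *\<^sub>R w"
proof -
  define x where "x = v - (v $ 1 / w $ 1) *\<^sub>R w"
  have "M132J r *v x = (- y) *s x"
    unfolding x_def matrix_vector_mult_diff_distrib matrix_vector_mult_scaleR v(1) w(1)
    by (simp add: vec_eq_iff algebra_simps)
  moreover have "x $ 1 = 0" using dominating_eigenvector_first_nonzero[OF w] by (simp add: x_def)
  ultimately have "x = 0" using dominating_eigenvector_first_nonzero by blast
  then show ?thesis by (simp add: x_def)
qed

lemma eigenvector_in_half_orbit:
  assumes v: "M132J r *v v = (- y) *s v" and pos: "0 < v $ 1"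
  shows "v \<in> half_orbit r"
proof -
  note s = eigen_signs[OF r(1,2) r4_less] and b = beta_less[OF r(1,2)]
  have "elim_det r y * v $ 3 < 0"
    unfolding eigen_third[OF v] using s(2) b pos r_pos by (simp add: mult_less_0_iff zero_less_mult_iff)
  then have 3: "v $ 3 < 0" using s(1) by (simp add: mult_less_0_iff)
  have "0 < elim_det r y * gap v r"
    unfolding eigen_gap[OF v] using gap_coeff_pos b pos r_pos by (intro mult_pos_pos) auto
  then have g: "0 < gap v r" using s(1) by (simp add: zero_less_mult_iff)
  have "elim_det r y * (P3 r *v (P1 r *v v)) $ 3 < 0"
    unfolding eigen_P3_P1_third[OF v] using s(3) pos r_pos by (simp add: mult_less_0_iff zero_less_mult_iff)
  then have "(P3 r *v (P1 r *v v)) $ 3 < 0" using s(1) by (simp add: mult_less_0_iff)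
  then show ?thesis
    using pos 3 g dominating_root_facts(1) by (simp add: half_orbit_def v mult_pos_neg)
qed

text \<open>With \<open>s = \<surd>m\<close>, where \<open>M\<^sup>2 q = m q\<close>, the vectors \<open>a = M q + s q\<close> and \<open>b = M q - s q\<close> satisfy
\<open>M a = s a\<close> and \<open>M b = - s b\<close>. The signs of the first coordinates exclude \<open>b = 0\<close>, so \<open>s = y\<close>; then
\<open>a \<noteq> 0\<close> would give a second eigenvalue \<open>y\<close> of maximal modulus.\<close>

lemma orbit_point_is_eigenvector:
  assumes q: "q \<in> half_orbit r" "- (M132J r *v q) \<in> half_orbit r"
    and fix_q: "normalize_vec (M132J r *v (M132J r *v q)) = q"
  shows "M132J r *v q = (- y) *s q"
proof -
  define z where "z = M132J r *v (M132J r *v q)"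
  define s where "s = sqrt (norm z)"
  have "(M132J r *v - (M132J r *v q)) $ 1 < 0" using q(2) unfolding half_orbit_def by simp
  then have "z \<noteq> 0" unfolding z_def by (auto simp: matrix_vector_mult_minus)
  then have s: "0 < s" "s * s = norm z" by (simp_all add: s_def)
  have "norm z *\<^sub>R normalize_vec z = z" using \<open>z \<noteq> 0\<close> by (simp add: normalize_vec_def)
  then have z: "M132J r *v (M132J r *v q) = (s * s) *\<^sub>R q" using fix_q s(2) by (simp add: z_def)
  define a b where "a = M132J r *v q + s *\<^sub>R q" and "b = M132J r *v q - s *\<^sub>R q"
  have a: "M132J r *v a = s *s a"
    by (simp add: a_def matrix_vector_right_distrib matrix_vector_mult_scaleR z vec_eq_iff algebra_simps)
  have b: "M132J r *v b = (- s) *s b"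
    by (simp add: b_def matrix_vector_mult_diff_distrib matrix_vector_mult_scaleR z vec_eq_iff algebra_simps)
  have "b \<noteq> 0"
  proof
    assume "b = 0"
    then have "(M132J r *v q) $ 1 = s * q $ 1" by (simp add: b_def)
    moreover have "(M132J r *v q) $ 1 < 0" "0 < q $ 1" using q(1) by (simp_all add: half_orbit_def)
    ultimately show False using s(1) by (metis less_asym mult_pos_pos)
  qed
  then have "eigenvalue (M132J r) (- s)" using b by (auto simp: eigenvalue_def eigenvector_def)
  then have "s = y" using positive_root_iff[OF s(1)] by (simp add: eigenvalue_M132J_real)
  have "a = 0"
  proof (rule ccontr)
    assume "a \<noteq> 0"
    then have "eigenvalue (M132J r) y" using a \<open>s = y\<close> by (auto simp: eigenvalue_def eigenvector_def)
    then have "qM r (- y) = 0" by (simp add: eigenvalue_M132J_real)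
    then have "eigenvalue (map_matrix complex_of_real (M132J r)) (of_real y)"
      unfolding eigenvalue_M132J_complex charpoly_factor[OF \<open>qM r (- y) = 0\<close>] by simp
    moreover have "complex_of_real y \<noteq> of_real (- y)" using dominating_root_facts(1) unfolding of_real_eq_iff by simp
    ultimately have "cmod (of_real y) < cmod (of_real (- y))"
      using dom unfolding dominating_eigenvalue_def by blast
    then show False by simp
  qed
  then have "M132J r *v q = - (y *\<^sub>R q)" unfolding a_def \<open>s = y\<close> by (simp add: eq_neg_iff_add_eq_0)
  then show ?thesis by (simp add: vec_eq_iff)
qed

lemma eigenvector_generates:
  assumes p: "M132J r *v p = (- y) *s p" "0 < p $ 1" "norm p = 1"
  shows "generates_orbit r [1, 3, 2, 3, 1, 2] p"
proof -
  have "- (M132J r *v p) = y *\<^sub>R p" using p(1) by (simp add: vec_eq_iff)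
  then have "- (M132J r *v p) \<in> half_orbit r"
    using half_orbit_scale[OF dominating_root_facts(1) eigenvector_in_half_orbit[OF p(1,2)]] by simp
  moreover have "M132J r *v (M132J r *v p) = (y * y) *\<^sub>R p"
  proof -
    have "M132J r *v p = (- y) *\<^sub>R p" using p(1) by (simp add: vec_eq_iff)
    then show ?thesis by (simp only: matrix_vector_mult_scaleR scaleR_scaleR) simp
  qed
  then have "normalize_vec (M132J r *v (M132J r *v p)) = p"
    using dominating_root_facts(1) p(3) by (simp add: normalize_vec_scale) (simp add: normalize_vec_def)
  ultimately show ?thesis
    using orbit_132312[OF r_pos(1)] eigenvector_in_half_orbit[OF p(1,2)] p(3) by simp
qed

text \<open>Let \<open>A = - M / y\<close>. Since \<open>A p = p\<close>, the iterates of \<open>v\<close> under \<open>A\<close> stay within a constant times the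
initial distance from \<open>p\<close>. Close to \<open>p\<close> the itinerary of six steps is the one of \<open>p\<close>, as it is given by
open conditions, so the normalized iterates of \<open>A\<^sup>2\<close> are the orbit of the return map.\<close>

lemma eigenvector_stable:
  assumes p: "M132J r *v p = (- y) *s p" "0 < p $ 1" "norm p = 1"
  shows "locally_stable_orbit r [1, 3, 2, 3, 1, 2] p"
proof -
  let ?w = "[1, 3, 2, 3, 1, 2] :: nat list"
  let ?F = "piter (bb_map r) (length ?w)"
  define A where "A = (- 1 / y) *\<^sub>R M132J r"
  define E where "E = {x. x \<in> half_orbit r \<and> - (M132J r *v x) \<in> half_orbit r}"
  have gen: "generates_orbit r ?w p" by (rule eigenvector_generates[OF p])
  have A: "A *v x = (- 1 / y) *\<^sub>R (M132J r *v x)" for x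
    by (simp only: A_def scaleR_matrix_vector_assoc)
  have Ap: "A *v p = p" using dominating_root_facts(1) by (simp add: A p(1) vec_eq_iff)
  have AA: "A *v (A *v x) = (1 / (y * y)) *\<^sub>R (M132J r *v (M132J r *v x))" for x
    by (simp only: A matrix_vector_mult_scaleR scaleR_scaleR) simp
  obtain C where C: "0 \<le> C" "\<And>h k. norm (((*v) A ^^ k) h) \<le> C * norm h"
    using normalized_M132J_power_bounded[OF r_pos(2) r(2) dom] unfolding A_def by blast
  have "open E"
  proof -
    have "E = half_orbit r \<inter> (\<lambda>x. - (M132J r *v x)) -` half_orbit r" by (auto simp: E_def)
    moreover have "continuous_on UNIV (\<lambda>x. - (M132J r *v x))"
      by (intro continuous_intros matrix_vector_mult_linear_continuous_on)
    ultimately show ?thesis using open_half_orbit by (metis open_Int open_vimage)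
  qed
  have orb: "q \<in> E" if "generates_orbit r ?w q" for q
    using that orbit_132312[OF r_pos(1)] by (simp add: E_def)
  have step: "?F (normalize_vec x) = Some (normalize_vec (A *v (A *v x)))" if "x \<in> E" for x
  proof -
    have pth: "\<forall>j<length ?w. orbit_vec r (take j ?w) x \<in> branch_cone r (?w ! j)"
      "orbit_vec r ?w x = M132J r *v (M132J r *v x)"
      using orbit_132312_path[OF r_pos(1)] that by (simp_all add: E_def)
    then have "?F (normalize_vec x) = Some (normalize_vec (orbit_vec r (take (length ?w) ?w) x))"
      by (intro piter_path order.refl)
    then show ?thesis using dominating_root_facts(1) by (simp only: take_all order.refl pth(2) AA) (simp add: normalize_vec_scale)
  qed
  have pS: "p \<in> phase_space"
    using p eigenvector_in_half_orbit[OF p(1,2)] by (simp add: phase_space_def half_orbit_def)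
  have np: "normalize_vec p = p" using p(3) by (simp add: normalize_vec_def)
  have "\<exists>\<delta>>0. \<forall>v\<in>phase_space. dist v p < \<delta> \<longrightarrow> (\<forall>k. \<exists>v'. piter ?F k v = Some v' \<and> dist v' p < e)"
    if "0 < e" for e
  proof -
    have "p \<noteq> 0" using p(3) by auto
    then have "((\<lambda>x. x /\<^sub>R norm x) \<longlongrightarrow> p /\<^sub>R norm p) (at p)" by (intro tendsto_intros) auto
    then have "(normalize_vec \<longlongrightarrow> p) (at p)" using np by (simp add: normalize_vec_def[abs_def])
    from tendstoD[OF this that] obtain \<eta>1 where d1: "0 < \<eta>1"
      "\<forall>x. x \<noteq> p \<and> dist x p < \<eta>1 \<longrightarrow> dist (normalize_vec x) p < e"
      unfolding eventually_at by auto
    have e1: "dist (normalize_vec x) p < e" if "dist x p < \<eta>1" for x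
      using d1(2) that np \<open>0 < e\<close> by (cases "x = p") auto
    obtain \<eta>2 where e2: "0 < \<eta>2" "\<And>x. dist x p < \<eta>2 \<Longrightarrow> x \<in> E"
      using \<open>open E\<close> orb[OF gen] unfolding open_dist by blast
    define \<delta> where "\<delta> = min \<eta>1 \<eta>2 / (C + 1)"
    have d: "0 < \<delta>" using d1(1) e2(1) C(1) by (simp add: \<delta>_def)
    have "\<exists>v'. piter ?F k v = Some v' \<and> dist v' p < e" if v: "v \<in> phase_space" "dist v p < \<delta>" for v k
    proof -
      define x where "x k = ((*v) A ^^ (2 * k)) v" for k
      have near: "dist (x k) p < min \<eta>1 \<eta>2" for k
      proof -
        have "((*v) A ^^ n) v - p = ((*v) A ^^ n) (v - p)" for n
        proof (induction n)
          case (Suc n)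
          have "((*v) A ^^ Suc n) v - p = A *v (((*v) A ^^ n) v - p)"
            by (simp add: matrix_vector_mult_diff_distrib Ap)
          then show ?case using Suc.IH by simp
        qed simp
        then have "dist (x k) p \<le> C * dist v p" using C(2)[of "2 * k" "v - p"] by (simp add: x_def dist_norm)
        also have "\<dots> \<le> (C + 1) * dist v p" by (simp add: mult_right_mono)
        also have "\<dots> < (C + 1) * \<delta>" using v(2) C(1) by simp
        finally show ?thesis using C(1) by (simp add: \<delta>_def)
      qed
      have "piter ?F k v = Some (normalize_vec (x k))"
      proof (induction k)
        case 0
        show ?case using v(1) by (simp add: x_def phase_space_def normalize_vec_def)
      next
        case (Suc k)
        have "x k \<in> E" using e2 near by simp
        moreover have "x (Suc k) = A *v (A *v x k)" by (simp add: x_def)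
        ultimately show ?case using Suc step by simp
      qed
      then show ?thesis using e1 near by simp
    qed
    then show ?thesis using d by blast
  qed
  then show ?thesis
    using gen pS unfolding locally_stable_orbit_def locally_stable_fixpoint_def generates_orbit_def by blast
qed
end

text \<open>A vanishing gap leaves only the roots of the quartic and of \<open>1 - 6r + r\<^sup>2\<close>. The latter means \<open>\<beta> = r\<close> and
\<open>y = r\<^sup>4\<close>, which is too small for the dominating root.\<close>

lemma critical_parameter_unique:
  assumes r: "0 < r" "r < 1" and y: "0 < y" "qM r y = 0" "r^11 < y^3"
    and v: "M132J r *v v = (- y) *s v" "v \<noteq> 0" and g: "gap v r = 0"
  shows "crit_poly r = 0"
proof -
  have yr: "y * (2 * beta r - r) = r^5" using gap_zero_imp[OF v(1) g v(2) r] .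
  have "1 - 6*r + r^2 \<noteq> 0"
  proof
    assume "1 - 6*r + r^2 = 0"
    then have "2 * beta r - r = r" by (simp add: beta_def power2_eq_square field_simps)
    then have "y = r^4" using yr r by (simp add: power_numeral_reduce)
    then have "r^11 < r^12" using y(3) by (simp flip: power_mult)
    moreover have "r^12 \<le> r^11" using r by (intro power_decreasing) auto
    ultimately show False by simp
  qed
  then show ?thesis using qM_at_critical[OF yr] y(2) r by simp
qed

text \<open>At a root of the quartic, \<open>r\<^sup>5 / (2\<beta> - r)\<close> is a positive root of \<open>q\<close>, hence the dominating one.\<close>

lemma gap_zero_at_critical:
  assumes r: "22/100 \<le> r" "r < 1" "crit_poly r = 0"
    and rs: "2 * beta r > r"
    and dom: "dominating_eigenvalue (M132J r) (of_real (- y))"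
    and v: "M132J r *v v = (- y) *s v"
  shows "gap v r = 0"
proof -
  have r0: "0 \<le> r" "0 < r" using r by simp_all
  have y: "0 < y" "qM r y = 0" "0 < trM r + y"
    using dominating_real[OF r0(1) r(2) dom] trace_plus_root_pos[OF r(1,2) dom] by simp_all
  define Y where "Y = r^5 / (2 * beta r - r)"
  have Y: "Y * (2 * beta r - r) = r^5" "0 < Y" using rs r0 by (simp_all add: Y_def)
  have "qM r Y = 0" using qM_at_critical[OF Y(1)] rs r(3) by simp
  then have "Y = y" using qM_sign(2)[OF r0(1) y Y(2)] by simp
  then have "(r - 2 * beta r) * y + r^5 = 0" using Y(1) by (simp add: algebra_simps)
  then have "elim_det r y * gap v r = 0" by (simp add: eigen_gap[OF v])
  moreover have "r^4 < y" using qM_sign(1)[OF r0(1) y, of "r^4"] qM_r4_neg[OF r(1,2)] r0 by simp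
  then have "0 < elim_det r y" using eigen_signs[OF r(1,2)] by blast
  ultimately show ?thesis by simp
qed

theorem theorem7p1:
  shows "(\<forall>r::real. 0 \<le> r \<and> r < 1 \<longrightarrow>
            (\<exists>l. dominating_eigenvalue (M132J r) l \<and> l \<in> \<real>)) \<and>
         (\<exists>rcrit::real.
            \<bar>rcrit - 0.22006978614631047521\<bar> < 1 / (2 * 10 ^ 20) \<and>
            (\<forall>(lam :: real \<Rightarrow> real) (u :: real \<Rightarrow> real^3).
               (\<forall>r. 0 \<le> r \<and> r < 1 \<longrightarrow>
                  dominating_eigenvalue (M132J r) (complex_of_real (lam r)) \<and>
                  eigenvector (M132J r) (u r) (lam r)) \<longrightarrow>
               {r. 0 < r \<and> r < 1 \<and> alpha r * u r $ 2 - u r $ 1 = 0} = {rcrit} \<and>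
               (\<forall>r. rcrit < r \<and> r < 1 \<longrightarrow>
                  (\<exists>p. {q. generates_orbit r [1, 3, 2, 3, 1, 2] q} = {p} \<and>
                       locally_stable_orbit r [1, 3, 2, 3, 1, 2] p \<and>
                       (p = normalize_vec (u r) \<or> p = - normalize_vec (u r))))))"
proof (intro conjI allI impI)
  fix r :: real
  assume r: "0 \<le> r \<and> r < 1"
  then obtain y where "0 < y" "qM r y = 0"
    "\<And>m. m^2 + of_real (- (trM r + y)) * m + of_real (y^2 + trM r * y + minM r) = 0 \<Longrightarrow> cmod m < y"
    using dominating_root_exists by blast
  then have "dominating_eigenvalue (M132J r) (of_real (- y))" by (rule dominating_of_root)
  then show "\<exists>l. dominating_eigenvalue (M132J r) l \<and> l \<in> \<real>" using Reals_of_real by blast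
next
  obtain rc where rc: "crit_poly rc = 0" "0.220069786146310475205 < rc" "rc < 0.22006978614631047521"
    by (rule crit_root_exists)
  have rc': "22/100 \<le> rc" "rc < 0.221" using rc by simp_all
  show "\<exists>rcrit::real.
            \<bar>rcrit - 0.22006978614631047521\<bar> < 1 / (2 * 10 ^ 20) \<and>
            (\<forall>(lam :: real \<Rightarrow> real) (u :: real \<Rightarrow> real^3).
               (\<forall>r. 0 \<le> r \<and> r < 1 \<longrightarrow>
                  dominating_eigenvalue (M132J r) (complex_of_real (lam r)) \<and>
                  eigenvector (M132J r) (u r) (lam r)) \<longrightarrow>
               {r. 0 < r \<and> r < 1 \<and> alpha r * u r $ 2 - u r $ 1 = 0} = {rcrit} \<and>
               (\<forall>r. rcrit < r \<and> r < 1 \<longrightarrow>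
                  (\<exists>p. {q. generates_orbit r [1, 3, 2, 3, 1, 2] q} = {p} \<and>
                       locally_stable_orbit r [1, 3, 2, 3, 1, 2] p \<and>
                       (p = normalize_vec (u r) \<or> p = - normalize_vec (u r)))))"
  proof (rule exI[of _ rc], intro conjI allI impI)
    show "\<bar>rc - 0.22006978614631047521\<bar> < 1 / (2 * 10 ^ 20)"
      using rc by (simp add: abs_if field_simps)
  next
    fix lam :: "real \<Rightarrow> real" and u :: "real \<Rightarrow> real^3"
    assume lam_u: "\<forall>r. 0 \<le> r \<and> r < 1 \<longrightarrow>
                  dominating_eigenvalue (M132J r) (complex_of_real (lam r)) \<and>
                  eigenvector (M132J r) (u r) (lam r)"
    have dom: "dominating_eigenvalue (M132J r) (of_real (- (- lam r)))" if "0 < r" "r < 1" for r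
      using lam_u that by simp
    have eig: "M132J r *v u r = (- (- lam r)) *s u r" "u r \<noteq> 0" if "0 < r" "r < 1" for r
      using lam_u that by (simp_all add: eigenvector_def)
    show "{r. 0 < r \<and> r < 1 \<and> alpha r * u r $ 2 - u r $ 1 = 0} = {rc}"
    proof (intro equalityI subsetI)
      fix r assume "r \<in> {r. 0 < r \<and> r < 1 \<and> alpha r * u r $ 2 - u r $ 1 = 0}"
      then have r: "0 < r" "r < 1" "gap (u r) r = 0" by (simp_all add: gap_def)
      note d = dominating_real[OF less_imp_le[OF r(1)] r(2) dom[OF r(1,2)]]
      have "crit_poly r = 0"
        by (rule critical_parameter_unique[OF r(1,2) _ _ _ eig[OF r(1,2)] r(3)]) (use d in simp_all)
      then have "\<not> r < rc" "\<not> rc < r"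
        using crit_poly_antimono[of r rc] crit_poly_antimono[of rc r] r rc(1) rc' by auto
      then show "r \<in> {rc}" by simp
    next
      fix r assume "r \<in> {rc}"
      then have [simp]: "r = rc" by simp
      have r: "0 < rc" "rc < 1" using rc' by simp_all
      have "rc^2 \<ge> 0.22^2" using rc' by (intro power_mono) auto
      then have "rc < 2 * beta rc" using rc' by (simp add: beta_def power2_eq_square field_simps)
      from gap_zero_at_critical[OF rc'(1) r(2) rc(1) this dom[OF r] eig(1)[OF r]]
      show "r \<in> {r. 0 < r \<and> r < 1 \<and> alpha r * u r $ 2 - u r $ 1 = 0}"
        using r by (simp add: gap_def)
    qed
  next
    fix lam :: "real \<Rightarrow> real" and u :: "real \<Rightarrow> real^3" and r :: real
    assume lam_u: "\<forall>r. 0 \<le> r \<and> r < 1 \<longrightarrow>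
                  dominating_eigenvalue (M132J r) (complex_of_real (lam r)) \<and>
                  eigenvector (M132J r) (u r) (lam r)"
      and "rc < r \<and> r < 1"
    then have r: "22/100 \<le> r" "r < 1" "0 < r" "crit_poly r < 0"
      using rc' crit_poly_antimono[of rc r] rc(1) by simp_all
    define y where "y = - lam r"
    have dom: "dominating_eigenvalue (M132J r) (of_real (- y))"
      and u: "M132J r *v u r = (- y) *s u r" "u r \<noteq> 0"
      using lam_u r by (simp_all add: y_def eigenvector_def)
    note ctx = r(1,2,4) dom
    have u1: "u r $ 1 \<noteq> 0" by (rule dominating_eigenvector_first_nonzero[OF ctx u])
    \<comment> \<open>Eigenvectors come with arbitrary sign and length; \<open>p\<close> is the representative in the phase space.\<close>
    define p where "p = (if 0 < u r $ 1 then normalize_vec (u r) else - normalize_vec (u r))"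
    have pu: "p = (sgn (u r $ 1) / norm (u r)) *\<^sub>R u r"
      using u1 by (simp add: p_def normalize_vec_def sgn_if divide_inverse)
    have n: "0 < norm (u r)" using u by simp
    have p: "M132J r *v p = (- y) *s p" "0 < p $ 1" "norm p = 1"
    proof -
      show "M132J r *v p = (- y) *s p"
        unfolding pu matrix_vector_mult_scaleR u(1) by (simp add: vec_eq_iff)
      show "0 < p $ 1" "norm p = 1" unfolding pu using u1 n by (auto simp: sgn_if)
    qed
    have unique: "q = p" if q: "generates_orbit r [1, 3, 2, 3, 1, 2] q" for q
    proof -
      have q': "norm q = 1" "q \<in> half_orbit r" "- (M132J r *v q) \<in> half_orbit r"
        "normalize_vec (M132J r *v (M132J r *v q)) = q"
        using q orbit_132312[OF r(3)] by simp_all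
      have qe: "M132J r *v q = (- y) *s q"
        by (rule orbit_point_is_eigenvector[OF ctx q'(2-4)])
      have q1: "0 < q $ 1" using q'(2) by (simp add: half_orbit_def)
      have "q \<noteq> 0" "p \<noteq> 0" using q'(1) p(3) by auto
      then have qp: "q = (q $ 1 / p $ 1) *\<^sub>R p" using eigenspace_line[OF ctx qe _ p(1)] by simp
      then have "norm q = \<bar>q $ 1 / p $ 1\<bar> * norm p" by (metis norm_scaleR)
      then have "q $ 1 / p $ 1 = 1" using q'(1) p q1 by simp
      then show ?thesis using qp by simp
    qed
    have "generates_orbit r [1, 3, 2, 3, 1, 2] q \<longleftrightarrow> q = p" for q
      using unique[of q] eigenvector_generates[OF ctx p] by blast
    then have "{q. generates_orbit r [1, 3, 2, 3, 1, 2] q} = {p}" by (simp only: singleton_conv)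
    moreover have "locally_stable_orbit r [1, 3, 2, 3, 1, 2] p" by (rule eigenvector_stable[OF ctx p])
    moreover have "p = normalize_vec (u r) \<or> p = - normalize_vec (u r)" by (simp add: p_def)
    ultimately show "\<exists>p. {q. generates_orbit r [1, 3, 2, 3, 1, 2] q} = {p} \<and>
                       locally_stable_orbit r [1, 3, 2, 3, 1, 2] p \<and>
                       (p = normalize_vec (u r) \<or> p = - normalize_vec (u r))" by blast
  qed
qed

end
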